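(* Let $I=(0,L)$ with $L>0$, let $p\ge 1$, $c_\infty>0$, $c_1\in(0,Lc_\infty]$ and $N\in\mathbb{N}_+$. The minimizers of the problem $$\min_{f\in X(c_\infty,c_1,N,I)} W_p(f_+,f_-)$$ are step functions, anti-symmetric about each nodal point (each point of $Z(f)$), with value $\pm c_\infty$ and width $c_1/(2c_\infty N)$ (that is, for each nodal point $z$, $f$ equals $c_\infty$ on one of the intervals $(z-d,z)$, $(z,z+d)$ and $-c_\infty$ on the other, where $d=c_1/(2c_\infty N)$, and $f=0$ elsewhere). These minimizers satisfy $$\min_{f\in X(c_\infty,c_1,N,I)} W_p(f_+,f_-)=2^{-\frac{p+1}{p}}\,\frac{c_1}{Nc_\infty}\,c_1^{\frac1p}.$$
   Context: Effective nodal set. For a measurable $f:I\to\mathbb{R}$ with finite $L^1$ and $L^\infty$ norms, let $Z_1(f)=\partial\{x: f(x)>0\}\cap\partial\{x: f(x)<0\}$. Let $\mathcal{Z}(f)$ be the set of connected components of $f^{-1}(\{0\})$, and $\mathcal{Z}'(f)\subseteq\mathcal{Z}(f)$ the set of those components whose closure intersects both $\partial\{f>0\}$ and $\partial\{f<0\}$. Let $Z_2(f)$ be a set consisting of a unique point $x\in J$ for every $J\in\mathcal{Z}'(f)$. The effective nodal set is $Z(f)=Z_1(f)\cup Z_2(f)$ (it captures every sign change of $f$ once). Admissible class. $X(c_\infty,c_1,N,I)$ is the set of measurable $f:I\to\mathbb{R}$ with $\|f\|_\infty=c_\infty$, $\|f\|_1=c_1$, $|Z(f)|=N$ and $\int_I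 f\,dx=0$. Transport. $f_\pm=\pm\max(\pm f,0)$, and $W_p(f_+,f_-)$ is the Wasserstein-$p$ distance between the two finite measures of equal mass with densities $f_+$ and $|f_-|$: $W_p(\mu_1,\mu_2)=\inf_{\gamma\in\Gamma(\mu_1,\mu_2)}\left(\int_{I\times I}|x-y|^p\,d\gamma(x,y)\right)^{1/p}$, where $\Gamma(\mu_1,\mu_2)$ is the set of Borel measures on $I\times I$ with marginals $\mu_1,\mu_2$ (no normalization to mass one). *)

theory Defs
  imports "HOL-Analysis.Analysis" "HOL-Probability.Essential_Supremum"
begin

(* A function on I is represented by f :: real => real; every notion below depends only on the
   values of f on I. Boundaries and closures are taken relative to the domain I. *)

definition pos_boundary :: "real set \<Rightarrow> (real \<Rightarrow> real) \<Rightarrow> real set" where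
  "pos_boundary I f = top_of_set I frontier_of {x \<in> I. f x > 0}"

definition neg_boundary :: "real set \<Rightarrow> (real \<Rightarrow> real) \<Rightarrow> real set" where
  "neg_boundary I f = top_of_set I frontier_of {x \<in> I. f x < 0}"

definition Z1 :: "real set \<Rightarrow> (real \<Rightarrow> real) \<Rightarrow> real set" where
  "Z1 I f = pos_boundary I f \<inter> neg_boundary I f"

definition sign_change_components :: "real set \<Rightarrow> (real \<Rightarrow> real) \<Rightarrow> real set set" where
  "sign_change_components I f =
     {J \<in> components {x \<in> I. f x = 0}.
        (top_of_set I closure_of J) \<inter> pos_boundary I f \<noteq> {} \<and>
        (top_of_set I closure_of J) \<inter> neg_boundary I f \<noteq> {}}"

definition transversal :: "'a set set \<Rightarrow> 'a set \<Rightarrow> bool" where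
  "transversal \<J> S \<longleftrightarrow> S \<subseteq> \<Union>\<J> \<and> (\<forall>J\<in>\<J>. \<exists>!x. x \<in> J \<inter> S)"

(* Z2 is not determined by f: it is an arbitrary choice of one point per component. The choice
   is therefore a parameter Z2 (one set for each function), required elsewhere to satisfy
   transversal (sign_change_components I f) (Z2 f). *)
definition nodal_set ::
    "((real \<Rightarrow> real) \<Rightarrow> real set) \<Rightarrow> real set \<Rightarrow> (real \<Rightarrow> real) \<Rightarrow> real set" where
  "nodal_set Z2 I f = Z1 I f \<union> Z2 f"

definition admissible ::
    "((real \<Rightarrow> real) \<Rightarrow> real set) \<Rightarrow> real \<Rightarrow> real \<Rightarrow> nat \<Rightarrow> real set \<Rightarrow> (real \<Rightarrow> real) set" where
  "admissible Z2 cinf c1 N I =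
     {f. f \<in> borel_measurable (lebesgue_on I) \<and>
         esssup (lebesgue_on I) (\<lambda>x. ennreal \<bar>f x\<bar>) = ennreal cinf \<and>
         (\<integral>\<^sup>+x. ennreal \<bar>f x\<bar> \<partial>lebesgue_on I) = ennreal c1 \<and>
         finite (nodal_set Z2 I f) \<and> card (nodal_set Z2 I f) = N \<and>
         (LINT x|lebesgue_on I. f x) = 0}"

definition pos_part :: "(real \<Rightarrow> real) \<Rightarrow> real \<Rightarrow> real" where
  "pos_part f x = max (f x) 0"

(* nonpositive, so that f = pos_part f + neg_part f *)
definition neg_part :: "(real \<Rightarrow> real) \<Rightarrow> real \<Rightarrow> real" where
  "neg_part f x = - max (- f x) 0"

(* The Borel measure on I with density |g|. Since g is only Lebesgue measurable, the density is
   taken on Lebesgue sets and then restricted to the Borel sets of I by the push-forward. *)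
definition density_measure :: "real set \<Rightarrow> (real \<Rightarrow> real) \<Rightarrow> real measure" where
  "density_measure I g =
     distr (density (lebesgue_on I) (\<lambda>x. ennreal \<bar>g x\<bar>)) (restrict_space borel I) (\<lambda>x. x)"

definition couplings :: "real set \<Rightarrow> real measure \<Rightarrow> real measure \<Rightarrow> (real \<times> real) measure set" where
  "couplings I \<mu> \<nu> =
     {\<gamma>. sets \<gamma> = sets (restrict_space borel (I \<times> I)) \<and>
         distr \<gamma> (restrict_space borel I) fst = \<mu> \<and>
         distr \<gamma> (restrict_space borel I) snd = \<nu>}"

(* Meant for bounded I and finite measures of equal mass: then the set of couplings is nonempty
   and all the integrals are finite, so the real-valued integral and infimum are the usual ones. *)
definition wasserstein :: "real \<Rightarrow> real set \<Rightarrow> real measure \<Rightarrow> real measure \<Rightarrow> real" where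
  "wasserstein p I \<mu> \<nu> =
     (INF \<gamma>\<in>couplings I \<mu> \<nu>. (LINT z|\<gamma>. \<bar>fst z - snd z\<bar> powr p) powr (1 / p))"

definition transport_cost :: "real \<Rightarrow> real set \<Rightarrow> (real \<Rightarrow> real) \<Rightarrow> real" where
  "transport_cost p I f =
     wasserstein p I (density_measure I (pos_part f)) (density_measure I (neg_part f))"

(* Equalities of values are a.e.: changing f at a single point where it equals c, to c / 2 say,
   affects neither the norms, nor the nodal set, nor the transport cost. *)
definition antisymmetric_step ::
    "real set \<Rightarrow> real set \<Rightarrow> real \<Rightarrow> real \<Rightarrow> (real \<Rightarrow> real) \<Rightarrow> bool" where
  "antisymmetric_step I Z c d f \<longleftrightarrow>
     (\<forall>z\<in>Z. {z - d<..<z + d} \<subseteq> I \<and>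
        (\<exists>s\<in>{c, - c}. AE x in lebesgue_on I.
           (x \<in> {z - d<..<z} \<longrightarrow> f x = s) \<and> (x \<in> {z<..<z + d} \<longrightarrow> f x = - s))) \<and>
     (AE x in lebesgue_on I. x \<notin> (\<Union>z\<in>Z. {z - d<..<z + d}) \<longrightarrow> f x = 0)"

end

theory Submission
  imports Defs
begin

text \<open>The nodal set is the set of points that mass has to cross.  If \<open>f x > 0 > f y\<close>, then some nodal
  point \<open>z\<close> lies between \<open>x\<close> and \<open>y\<close>, so that \<open>\<bar>x - y\<bar>\<close> is at least the distance of \<open>x\<close> to the nodal
  set plus the distance of \<open>y\<close> to it.  Integrated against any coupling of the positive and the
  negative part, this bounds the mean transport distance from below by the integral of
  \<open>\<bar>f\<bar> * dist (\<cdot>, Z)\<close>, which no longer mentions the coupling.  The exponent \<open>p\<close> is reduced to \<open>1\<close> by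
  the tangent of \<open>t \<mapsto> t powr p\<close> at \<open>t = d\<close>, where \<open>d = c1 / (2 * cinf * N)\<close> is the distance over
  which the claimed minimizers move every particle.

  Minimizing the integral of \<open>\<bar>f\<bar> * dist (\<cdot>, Z)\<close> under \<open>\<bar>f\<bar> \<le> cinf\<close> and \<open>\<integral>\<bar>f\<bar> = c1\<close> is a bathtub
  problem: \<open>\<bar>f\<bar>\<close> should fill the neighbourhood of \<open>Z\<close> up to the height \<open>cinf\<close>.  The radius-\<open>d\<close>
  neighbourhoods of \<open>N\<close> points have total length at most \<open>2 * N * d\<close>, and \<open>d\<close> is the radius for which
  this length holds exactly the mass \<open>c1\<close>.  The inequality is proved by integrating the pointwise
  nonnegative function \<open>excess\<close>, in which the neighbourhood is replaced by a sum of tents; the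
  transport cost controls the integral of \<open>excess\<close>, so for a minimizer \<open>excess\<close> vanishes almost
  everywhere.  This forces \<open>\<bar>f\<bar> = cinf\<close> on pairwise disjoint intervals \<open>(z - d, z + d)\<close> and \<open>f = 0\<close>
  elsewhere (\<open>minimizer_structure\<close>).

  It remains to exclude that \<open>f\<close> has the same sign on both sides of a nodal point \<open>z\<close>, which can happen
  because the nodal set depends on the values of \<open>f\<close> on null sets.  In that case the other \<open>N - 1\<close>
  points already separate the two signs, and the lower bound for \<open>N - 1\<close> points is strictly larger.
  Conversely, an antisymmetric step function attains the bound: shifting each positive half cell by
  \<open>d\<close> onto the adjacent negative one is a coupling that moves everything by exactly \<open>d\<close>.  A step
  function with alternating orientation shows that the admissible class contains such a function:
  since neighbouring cells then carry the same sign where they meet, no further nodal points arise.\<close>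

section \<open>Sign changes cross the nodal set\<close>

definition separates :: "real set \<Rightarrow> (real \<Rightarrow> real) \<Rightarrow> bool" where
  "separates S f \<longleftrightarrow> (\<forall>x y. f x > 0 \<longrightarrow> f y < 0 \<longrightarrow> (\<exists>z\<in>S. z \<in> closed_segment x y))"

text \<open>The set \<open>B\<close> is any witness that \<open>x\<close> is adherent to the complement of \<open>A\<close>: the opposite sign set or
  an interval of zeros.\<close>

lemma frontier_of_adherent:
  assumes "A \<subseteq> I" "B \<subseteq> I - A" "x \<in> I" "x \<in> closure A" "x \<in> closure B"
  shows "x \<in> top_of_set I frontier_of A"
proof -
  have "x \<in> top_of_set I closure_of A" "x \<in> top_of_set I closure_of B"
    using assms by (auto simp: closure_of_subtopology Int_absorb1 Diff_subset)
     (metis Diff_subset Int_absorb1 dual_order.trans)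
  moreover have "top_of_set I closure_of B \<subseteq> top_of_set I closure_of (topspace (top_of_set I) - A)"
    using assms by (intro closure_of_mono) auto
  ultimately show ?thesis by (auto simp: frontier_of_closures)
qed

text \<open>Let \<open>a\<close> be the supremum of the points of the segment that have the sign of \<open>x\<close>, and \<open>b\<close> the
  infimum of the points from \<open>a\<close> on that have the opposite sign.  If \<open>a = b\<close>, this point lies on both
  boundaries.  Otherwise \<open>f\<close> vanishes on \<open>(a, b)\<close>, and the component of the zero set that contains this interval
  touches both boundaries; it cannot reach \<open>x\<close> or \<open>y\<close>, so its representative lies between them.
  The factor \<open>s\<close> treats both orders of the two signs at once.\<close>

lemma nodal_point_between_signs:
  fixes x y s :: real
  assumes I: "is_interval I" and xy: "x \<in> I" "y \<in> I" "x < y"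
    and s: "s = 1 \<or> s = -1" and fx: "s * f x > 0" and fy: "s * f y < 0"
    and tr: "transversal (sign_change_components I f) (Z2 f)"
  shows "\<exists>z\<in>nodal_set Z2 I f. x \<le> z \<and> z \<le> y"
proof -
  define A where "A = {t\<in>I. s * f t > 0}"
  define B where "B = {t\<in>I. s * f t < 0}"
  have AB: "{pos_boundary I f, neg_boundary I f} =
      {top_of_set I frontier_of A, top_of_set I frontier_of B}"
    using s by (auto simp: pos_boundary_def neg_boundary_def A_def B_def)
  have sub: "{x..y} \<subseteq> I"
    using mem_is_interval_1_I[OF I xy(1,2)] by auto
  define a where "a = Sup (A \<inter> {x..y})"
  have xA: "x \<in> A \<inter> {x..y}" using xy fx by (auto simp: A_def)
  have bdA: "bdd_above (A \<inter> {x..y})" by (auto intro: bdd_above_mono[of "{x..y}"])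
  have a: "x \<le> a" unfolding a_def by (rule cSup_upper[OF xA bdA])
  have a': "a \<le> y" unfolding a_def by (rule cSup_least) (use xA in auto)
  note a = a a'
  have aclA: "a \<in> closure A"
  proof -
    have "a \<in> closure (A \<inter> {x..y})"
      unfolding a_def by (rule closure_contains_Sup) (use xA bdA in auto)
    then show ?thesis using closure_mono[of "A \<inter> {x..y}" A] by blast
  qed
  have after: "s * f t \<le> 0" if "a < t" "t \<le> y" for t
  proof (rule ccontr)
    assume "\<not> s * f t \<le> 0"
    then have "t \<in> A \<inter> {x..y}" using that a sub by (auto simp: A_def)
    then have "t \<le> a" unfolding a_def by (rule cSup_upper[OF _ bdA])
    then show False using that by simp
  qed
  define b where "b = Inf (B \<inter> {a..y})"
  have yB: "y \<in> B \<inter> {a..y}" using xy fy a by (auto simp: B_def)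
  have bdB: "bdd_below (B \<inter> {a..y})" by (auto intro: bdd_below_mono[of "{a..y}"])
  have b: "b \<le> y" unfolding b_def by (rule cInf_lower[OF yB bdB])
  have b': "a \<le> b" unfolding b_def by (rule cInf_greatest) (use yB in auto)
  note b = b' b
  have bclB: "b \<in> closure B"
  proof -
    have "b \<in> closure (B \<inter> {a..y})"
      unfolding b_def by (rule closure_contains_Inf) (use yB bdB in auto)
    then show ?thesis using closure_mono[of "B \<inter> {a..y}" B] by blast
  qed
  have before: "0 \<le> s * f t" if "a \<le> t" "t < b" for t
  proof (rule ccontr)
    assume "\<not> 0 \<le> s * f t"
    then have "t \<in> B \<inter> {a..y}" using that a b sub by (auto simp: B_def)
    then have "b \<le> t" unfolding b_def by (rule cInf_lower[OF _ bdB])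
    then show False using that by simp
  qed
  have aI: "a \<in> I" and bI: "b \<in> I" using a b sub by auto
  show ?thesis
  proof (cases "a = b")
    case True
    have "a \<in> top_of_set I frontier_of A"
      by (rule frontier_of_adherent[where B=B]) (use True aclA bclB aI in \<open>auto simp: A_def B_def\<close>)
    moreover have "a \<in> top_of_set I frontier_of B"
      by (rule frontier_of_adherent[where B=A]) (use True aclA bclB aI in \<open>auto simp: A_def B_def\<close>)
    ultimately have "a \<in> Z1 I f" using AB by (auto simp: Z1_def doubleton_eq_iff)
    then show ?thesis using a by (auto simp: nodal_set_def)
  next
    case False
    with b have ab: "a < b" by simp
    have zero: "f t = 0" if "t \<in> {a<..<b}" for t
      using after[of t] before[of t] that b s by auto
    define Zr where "Zr = {t\<in>I. f t = 0}"
    have gap: "{a<..<b} \<subseteq> Zr" using zero sub a b by (auto simp: Zr_def)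
    define m where "m = (a + b) / 2"
    have m: "m \<in> {a<..<b}" using ab by (auto simp: m_def)
    define J where "J = connected_component_set Zr m"
    have J: "J \<in> components Zr" using gap m unfolding J_def by (auto simp: components_def)
    have gapJ: "{a<..<b} \<subseteq> J"
      unfolding J_def using gap m by (intro connected_component_maximal) auto
    have clos: "{a..b} \<subseteq> closure J"
      using closure_mono[OF gapJ] ab by (simp add: closure_greaterThanLessThan)
    have "a \<in> top_of_set I frontier_of A"
      by (rule frontier_of_adherent[where B="{a<..<b}"])
         (use aclA aI ab a b zero sub in \<open>auto simp: A_def closure_greaterThanLessThan\<close>)
    moreover have "b \<in> top_of_set I frontier_of B"
      by (rule frontier_of_adherent[where B="{a<..<b}"])
         (use bclB bI ab a b zero sub in \<open>auto simp: B_def closure_greaterThanLessThan\<close>)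
    moreover have "J \<subseteq> I" using J in_components_subset by (fastforce simp: Zr_def)
    then have "a \<in> top_of_set I closure_of J" "b \<in> top_of_set I closure_of J"
      using clos ab aI bI by (auto simp: closure_of_subtopology Int_absorb1)
    ultimately have "J \<in> sign_change_components I f"
      using J AB unfolding sign_change_components_def Zr_def by (auto simp: doubleton_eq_iff)
    then obtain z where z: "z \<in> J" "z \<in> Z2 f" using tr by (auto simp: transversal_def)
    have "connected J" using J in_components_connected by blast
    then have cJ: "is_interval J" by (simp add: is_interval_connected_1)
    have JZ: "J \<subseteq> Zr" using J in_components_subset by blast
    then have "x \<notin> J" "y \<notin> J" using fx fy by (auto simp: Zr_def)
    moreover have "m \<in> J" using m gapJ by blast
    moreover have "x \<le> m" "m \<le> y" using m a b by auto
    ultimately have "x \<le> z" "z \<le> y"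
      using cJ z(1) unfolding is_interval_1 by (metis linear)+
    then show ?thesis using z by (auto simp: nodal_set_def)
  qed
qed

text \<open>The function \<open>g\<close> may vanish at points where \<open>f\<close> does not, since a Borel representative of \<open>f\<close> is
  obtained by setting \<open>f\<close> to zero on a null set.  Separation is stated pointwise and survives this.\<close>

lemma nodal_set_separates:
  assumes I: "is_interval I"
    and tr: "transversal (sign_change_components I f) (Z2 f)"
    and g: "\<And>x. g x = 0 \<or> x \<in> I \<and> g x = f x"
  shows "separates (nodal_set Z2 I f) g"
  unfolding separates_def
proof (intro allI impI)
  fix x y assume "g x > 0" "g y < 0"
  then have *: "x \<in> I" "y \<in> I" "f x > 0" "f y < 0" using g by (metis less_irrefl)+
  then consider "x < y" | "y < x" by (metis linorder_cases order.asym)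
  then show "\<exists>z\<in>nodal_set Z2 I f. z \<in> closed_segment x y"
  proof cases
    case 1
    then show ?thesis using nodal_point_between_signs[OF I *(1,2), of 1 f Z2] * tr
      by (auto simp: closed_segment_eq_real_ivl)
  next
    case 2
    then show ?thesis using nodal_point_between_signs[OF I *(2,1), of "-1" f Z2] * tr
      by (auto simp: closed_segment_eq_real_ivl)
  qed
qed

section \<open>A bathtub inequality for the distance to finitely many points\<close>

text \<open>The tents bound \<open>max (d - infdist x S) 0\<close> from above, with equality where the intervals of radius
  \<open>d\<close> around the points of \<open>S\<close> do not overlap.  Their integral does not depend on the position of
  these points.\<close>

definition tents :: "real set \<Rightarrow> real \<Rightarrow> real \<Rightarrow> real" where
  "tents S d x = (\<Sum>z\<in>S. max (d - \<bar>x - z\<bar>) 0)"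

lemma infdist_real_attained:
  fixes x :: real
  assumes "finite S" "S \<noteq> {}"
  obtains z where "z \<in> S" "infdist x S = \<bar>x - z\<bar>"
  using infdist_attains_inf[of S x] assms finite_imp_closed by (metis dist_real_def)

lemma tents_ge_infdist:
  assumes "finite S" "S \<noteq> {}"
  shows "d - infdist x S \<le> tents S d x" "0 \<le> tents S d x"
proof -
  obtain z where z: "z \<in> S" "infdist x S = \<bar>x - z\<bar>" using infdist_real_attained assms .
  have "d - \<bar>x - z\<bar> \<le> max (d - \<bar>x - z\<bar>) 0" by simp
  also have "\<dots> \<le> tents S d x"
    unfolding tents_def by (rule member_le_sum) (use z assms in auto)
  finally show "d - infdist x S \<le> tents S d x" using z by simp
  show "0 \<le> tents S d x" unfolding tents_def by (rule sum_nonneg) auto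
qed

lemma bathtub_nonneg:
  assumes S: "finite S" "S \<noteq> {}" and v: "0 \<le> v" "v \<le> c"
  shows "0 \<le> (infdist x S - d) * v + c * tents S d x"
proof (cases "infdist x S \<ge> d")
  case True
  then show ?thesis using tents_ge_infdist[OF S, of d x] v by simp
next
  case False
  then have "(d - infdist x S) * v \<le> (d - infdist x S) * c" using v by (intro mult_left_mono) auto
  also have "\<dots> \<le> tents S d x * c"
    using tents_ge_infdist[OF S, of d x] v by (intro mult_right_mono) auto
  finally show ?thesis by (simp add: algebra_simps)
qed

text \<open>In the equality case nothing is lost in \<open>v \<le> c\<close> inside the neighbourhood of \<open>S\<close>, nothing lies
  outside of it, and the tents do not overlap.\<close>

lemma bathtub_equality:
  assumes S: "finite S" "S \<noteq> {}" and v: "0 \<le> v" "v \<le> c" "0 < c"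
    and eq: "(infdist x S - d) * v + c * tents S d x = 0"
  shows "infdist x S > d \<Longrightarrow> v = 0"
    and "z \<in> S \<Longrightarrow> \<bar>x - z\<bar> < d \<Longrightarrow> v = c"
    and "z \<in> S \<Longrightarrow> z' \<in> S \<Longrightarrow> \<bar>x - z\<bar> < d \<Longrightarrow> \<bar>x - z'\<bar> < d \<Longrightarrow> z = z'"
proof -
  show "v = 0" if "infdist x S > d"
  proof (rule ccontr)
    assume "v \<noteq> 0"
    then have "0 < (infdist x S - d) * v" using v that by auto
    moreover have "0 \<le> c * tents S d x" using tents_ge_infdist[OF S, of d x] v by simp
    ultimately show False using eq by simp
  qed
  {
    fix z assume z: "z \<in> S" "\<bar>x - z\<bar> < d"
    have "infdist x S \<le> \<bar>x - z\<bar>" using infdist_le[OF z(1), of x] by (simp add: dist_real_def)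
    then have i: "infdist x S < d" using z by simp
    have "c * (d - infdist x S) \<le> c * tents S d x"
      using tents_ge_infdist[OF S, of d x] v by (intro mult_left_mono) auto
    then have "c * (d - infdist x S) \<le> v * (d - infdist x S)" using eq by (simp add: algebra_simps)
    then have "c \<le> v" using i by simp
    then have "v = c" using v by simp
    then have "c * (tents S d x - (d - infdist x S)) = 0" using eq by (simp add: algebra_simps)
    then have "tents S d x = d - infdist x S" using v by simp
    note \<open>v = c\<close> this
  } note * = this
  show "v = c" if "z \<in> S" "\<bar>x - z\<bar> < d" using * that by blast
  show "z = z'" if "z \<in> S" "z' \<in> S" "\<bar>x - z\<bar> < d" "\<bar>x - z'\<bar> < d"
  proof -
    have **: "z1 = w" if w: "w \<in> S" "infdist x S = \<bar>x - w\<bar>" and z1: "z1 \<in> S" "\<bar>x - z1\<bar> < d" for z1 w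
    proof (rule ccontr)
      assume "z1 \<noteq> w"
      have "(\<Sum>z\<in>{z1, w}. max (d - \<bar>x - z\<bar>) 0) \<le> tents S d x"
        unfolding tents_def by (rule sum_mono2) (use S w z1 in auto)
      then have "max (d - \<bar>x - z1\<bar>) 0 + max (d - \<bar>x - w\<bar>) 0 \<le> tents S d x"
        using \<open>z1 \<noteq> w\<close> by simp
      moreover have "tents S d x = d - \<bar>x - w\<bar>" using *(2)[OF z1] w by simp
      ultimately show False using z1 by auto
    qed
    obtain w where "w \<in> S" "infdist x S = \<bar>x - w\<bar>" using infdist_real_attained S .
    then show ?thesis using **[of w z] **[of w z'] that by auto
  qed
qed

lemma has_bochner_integral_tent:
  assumes "0 < (d::real)"
  shows "has_bochner_integral lborel (\<lambda>x. max (d - \<bar>x - z\<bar>) 0) (d\<^sup>2)"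
proof -
  have 1: "has_bochner_integral lborel (\<lambda>x. (d + (x - z)) * indicator {z - d..z} x) (d\<^sup>2/2)"
  proof -
    have "has_bochner_integral lborel (\<lambda>x. (d + (x - z)) * indicator {z - d..z} x)
        ((d + (z - z))\<^sup>2 / 2 - (d + (z - d - z))\<^sup>2 / 2)"
      by (rule has_bochner_integral_FTC_Icc_real)
         (use assms in \<open>auto intro!: derivative_eq_intros continuous_intros\<close>)
    then show ?thesis by simp
  qed
  have 2: "has_bochner_integral lborel (\<lambda>x. (d - (x - z)) * indicator {z..z + d} x) (d\<^sup>2/2)"
  proof -
    have "has_bochner_integral lborel (\<lambda>x. (d - (x - z)) * indicator {z..z + d} x)
        ((d * (z + d) - ((z + d) - z)\<^sup>2 / 2) - (d * z - (z - z)\<^sup>2 / 2))"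
      by (rule has_bochner_integral_FTC_Icc_real)
         (use assms in \<open>auto intro!: derivative_eq_intros continuous_intros simp: diff_divide_distrib\<close>)
    then show ?thesis by (simp add: algebra_simps power2_eq_square)
  qed
  have "has_bochner_integral lborel (\<lambda>x. (d + (x - z)) * indicator {z - d..z} x +
      (d - (x - z)) * indicator {z..z + d} x) (d\<^sup>2/2 + d\<^sup>2/2)"
    using 1 2 by (rule has_bochner_integral_add)
  moreover have "AE x in lborel. x \<noteq> z" by (rule AE_lborel_singleton)
  then have "AE x in lborel. (d + (x - z)) * indicator {z - d..z} x +
      (d - (x - z)) * indicator {z..z + d} x = max (d - \<bar>x - z\<bar>) 0"
    by eventually_elim (auto simp: indicator_def max_def abs_if)
  ultimately show ?thesis
    by (subst (asm) has_bochner_integral_cong_AE) (auto simp: algebra_simps)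
qed

lemma has_bochner_integral_tents:
  assumes "finite S" "0 < d"
  shows "has_bochner_integral lborel (tents S d) (real (card S) * d\<^sup>2)"
proof -
  have "has_bochner_integral lborel (\<lambda>x. \<Sum>z\<in>S. max (d - \<bar>x - z\<bar>) 0) (\<Sum>z\<in>S. d\<^sup>2)"
    by (intro has_bochner_integral_sum has_bochner_integral_tent assms)
  then show ?thesis by (simp add: tents_def[abs_def])
qed

section \<open>Measures with a given density and their couplings\<close>

text \<open>Signs of \<open>f\<close> have to be evaluated along couplings, which are Borel measures, whereas \<open>f\<close> is only
  Lebesgue measurable.  Setting the exceptional null set to zero keeps the sign information of \<open>f\<close>
  that \<open>separates\<close> needs.\<close>

lemma borel_representative:
  assumes I: "I \<in> sets borel" and f: "f \<in> borel_measurable (lebesgue_on I)"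
  obtains g :: "real \<Rightarrow> real" where "g \<in> borel_measurable borel"
    "\<And>x. g x = 0 \<or> x \<in> I \<and> g x = f x" "AE x in lebesgue_on I. g x = f x"
proof -
  have IL: "I \<in> sets lebesgue" using I by (simp add: sets_completionI_sets)
  have "(\<lambda>x. if x \<in> I then f x else 0) \<in> borel_measurable lebesgue"
    using f IL by (simp add: borel_measurable_if)
  then obtain g' where g': "g' \<in> borel_measurable lborel"
    and "AE x in lborel. (if x \<in> I then f x else 0) = g' x"
    using completion_ex_borel_measurable_real by blast
  then obtain N where N: "N \<in> null_sets lborel"
    and sub: "{x. (if x \<in> I then f x else 0) \<noteq> g' x} \<subseteq> N"
    by (auto simp: eventually_ae_filter)
  define g where "g x = (if x \<in> N then 0 else g' x)" for x
  have "{x \<in> space borel. x \<in> N} \<in> sets borel" using N by auto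
  then have 1: "g \<in> borel_measurable borel"
    unfolding g_def using g' by (intro measurable_If) auto
  have *: "(if x \<in> I then f x else 0) = g' x" if "x \<notin> N" for x using sub that by blast
  have 2: "g x = 0 \<or> x \<in> I \<and> g x = f x" for x
    using *[of x] by (auto simp: g_def split: if_splits)
  have "N \<in> null_sets lebesgue" using N by (simp add: null_sets_completionI)
  then have "AE x in lebesgue. x \<notin> N" by (rule AE_not_in)
  then have "AE x in lebesgue. x \<in> I \<longrightarrow> g x = f x"
  proof eventually_elim
    case (elim x)
    then show ?case using *[of x] by (auto simp: g_def)
  qed
  then have 3: "AE x in lebesgue_on I. g x = f x"
    using IL by (simp add: AE_restrict_space_iff)
  show thesis using that 1 2 3 by blast
qed

lemma borel_imp_lebesgue_on:
  fixes g :: "real \<Rightarrow> 'a::topological_space"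
  assumes "g \<in> borel_measurable borel"
  shows "g \<in> borel_measurable (lebesgue_on I)"
  using assms by (intro measurable_restrict_space1 measurable_completion) simp

lemma integral_lebesgue_on_eq_lborel:
  fixes g :: "real \<Rightarrow> real"
  assumes "I \<in> sets borel" "g \<in> borel_measurable borel" "\<And>x. x \<notin> I \<Longrightarrow> g x = 0"
  shows "(LINT x|lebesgue_on I. g x) = (LINT x|lborel. g x)"
proof -
  have "(LINT x|lebesgue_on I. g x) = (LINT x|lebesgue. indicator I x *\<^sub>R g x)"
    using assms(1) by (intro integral_restrict_space) (auto simp: sets_completionI_sets)
  also have "\<dots> = (LINT x|lebesgue. g x)"
    using assms(3) by (intro Bochner_Integration.integral_cong) (auto simp: indicator_def)
  also have "\<dots> = (LINT x|lborel. g x)"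
    using assms(2) by (intro integral_completion) simp
  finally show ?thesis .
qed

lemma nn_integral_lebesgue_on_eq_lborel:
  fixes g :: "real \<Rightarrow> ennreal"
  assumes "I \<in> sets borel" "g \<in> borel_measurable borel" "\<And>x. x \<notin> I \<Longrightarrow> g x = 0"
  shows "(\<integral>\<^sup>+x. g x \<partial>lebesgue_on I) = (\<integral>\<^sup>+x. g x \<partial>lborel)"
proof -
  have "(\<integral>\<^sup>+x. g x \<partial>lebesgue_on I) = (\<integral>\<^sup>+x. g x * indicator I x \<partial>lebesgue)"
    using assms(1) by (intro nn_integral_restrict_space) (auto simp: sets_completionI_sets)
  also have "\<dots> = (\<integral>\<^sup>+x. g x \<partial>lebesgue)"
    using assms(3) by (intro nn_integral_cong) (auto simp: indicator_def)
  also have "\<dots> = (\<integral>\<^sup>+x. g x \<partial>lborel)"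
    using assms(2) by (simp add: nn_integral_completion)
  finally show ?thesis .
qed

lemma density_measure_cong_AE:
  assumes "f \<in> borel_measurable (lebesgue_on I)" "g \<in> borel_measurable (lebesgue_on I)"
    "AE x in lebesgue_on I. f x = g x"
  shows "density_measure I f = density_measure I g"
  unfolding density_measure_def using assms
  by (intro arg_cong[where f="\<lambda>M. distr M _ _"] density_cong) auto

lemma sets_density_measure [simp, measurable_cong]:
  "sets (density_measure I g) = sets (restrict_space borel I)"
  by (simp add: density_measure_def)

lemma space_density_measure [simp]: "space (density_measure I g) = I"
  by (simp add: density_measure_def space_restrict_space)

lemma measurable_id_lebesgue_on: "(\<lambda>x. x) \<in> lebesgue_on I \<rightarrow>\<^sub>M restrict_space (borel :: real measure) I"
  by (intro measurable_restrict_space3 measurable_completion) auto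

lemma nn_integral_density_measure:
  assumes I: "I \<in> sets borel" and g: "g \<in> borel_measurable borel" "\<And>x. x \<notin> I \<Longrightarrow> g x = 0"
    and u: "u \<in> borel_measurable borel"
  shows "(\<integral>\<^sup>+x. u x \<partial>density_measure I g) = (\<integral>\<^sup>+x. ennreal \<bar>g x\<bar> * u x \<partial>lborel)"
proof -
  note [measurable] = borel_imp_lebesgue_on[OF g(1)] borel_imp_lebesgue_on[OF u] g(1) u
  have "(\<integral>\<^sup>+x. u x \<partial>density_measure I g) =
      (\<integral>\<^sup>+x. u x \<partial>density (lebesgue_on I) (\<lambda>x. ennreal \<bar>g x\<bar>))"
    unfolding density_measure_def
    by (intro nn_integral_distr) (simp_all add: measurable_id_lebesgue_on measurable_restrict_space1 u)
  also have "\<dots> = (\<integral>\<^sup>+x. ennreal \<bar>g x\<bar> * u x \<partial>lebesgue_on I)"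
    by (rule nn_integral_density) measurable
  also have "\<dots> = (\<integral>\<^sup>+x. ennreal \<bar>g x\<bar> * u x \<partial>lborel)"
    by (rule nn_integral_lebesgue_on_eq_lborel) (use I g in auto)
  finally show ?thesis .
qed

lemma emeasure_density_measure:
  assumes I: "I \<in> sets borel" and g: "g \<in> borel_measurable borel" "\<And>x. x \<notin> I \<Longrightarrow> g x = 0"
    and B: "B \<in> sets (restrict_space borel I)"
  shows "emeasure (density_measure I g) B = (\<integral>\<^sup>+x. ennreal \<bar>g x\<bar> * indicator B x \<partial>lborel)"
proof -
  have "B \<in> sets borel" using B I by (auto simp: sets_restrict_space_iff)
  then show ?thesis
    using nn_integral_density_measure[OF I g, of "indicator B"] B by simp
qed

lemma integral_density_measure:
  fixes u :: "real \<Rightarrow> real"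
  assumes I: "I \<in> sets borel" and g: "g \<in> borel_measurable borel" "\<And>x. x \<notin> I \<Longrightarrow> g x = 0"
    and u: "u \<in> borel_measurable borel"
  shows "(LINT x|density_measure I g. u x) = (LINT x|lborel. \<bar>g x\<bar> * u x)"
proof -
  note [measurable] = borel_imp_lebesgue_on[OF g(1)] borel_imp_lebesgue_on[OF u] g(1) u
  have "(LINT x|density_measure I g. u x) =
      (LINT x|density (lebesgue_on I) (\<lambda>x. ennreal \<bar>g x\<bar>). u x)"
    unfolding density_measure_def
    by (intro integral_distr measurable_restrict_space1 u)
       (simp add: measurable_id_lebesgue_on)
  also have "\<dots> = (LINT x|lebesgue_on I. \<bar>g x\<bar> * u x)"
    by (rule integral_real_density) (simp_all add: borel_imp_lebesgue_on g u)
  also have "\<dots> = (LINT x|lborel. \<bar>g x\<bar> * u x)"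
    by (rule integral_lebesgue_on_eq_lborel) (use I g in auto)
  finally show ?thesis .
qed

lemma AE_density_measure:
  assumes I: "I \<in> sets borel" and g: "g \<in> borel_measurable borel"
    and P: "{x. P x} \<in> sets borel" and imp: "\<And>x. g x \<noteq> 0 \<Longrightarrow> P x"
  shows "AE x in density_measure I g. P x"
proof -
  have "{x \<in> space (restrict_space borel I). P x} \<in> sets (restrict_space borel I)"
    using sets.Int[OF P I] I by (auto simp: sets_restrict_space_iff space_restrict_space Int_def conj_commute)
  then have "(AE x in density_measure I g. P x) \<longleftrightarrow>
      (AE x in density (lebesgue_on I) (\<lambda>x. ennreal \<bar>g x\<bar>). P x)"
    unfolding density_measure_def
    by (intro AE_distr_iff) (simp_all add: measurable_id_lebesgue_on)
  also have "\<dots> \<longleftrightarrow> (AE x in lebesgue_on I. 0 < ennreal \<bar>g x\<bar> \<longrightarrow> P x)"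
    using borel_imp_lebesgue_on[OF g] by (intro AE_density) simp
  also have \<dots> using imp by auto
  finally show ?thesis .
qed

lemma measurable_coupling_projections:
  assumes "\<gamma> \<in> couplings I \<mu> \<nu>"
  shows "fst \<in> \<gamma> \<rightarrow>\<^sub>M restrict_space borel I" "snd \<in> \<gamma> \<rightarrow>\<^sub>M restrict_space borel I"
    "h \<in> borel_measurable borel \<Longrightarrow> h \<in> borel_measurable \<gamma>" "space \<gamma> = I \<times> I"
proof -
  have s: "sets \<gamma> = sets (restrict_space borel (I \<times> I))" using assms by (simp add: couplings_def)
  show "fst \<in> \<gamma> \<rightarrow>\<^sub>M restrict_space borel I" "snd \<in> \<gamma> \<rightarrow>\<^sub>M restrict_space borel I"
    by (subst measurable_cong_sets[OF s refl], rule measurable_restrict_space3;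
        auto intro!: borel_measurable_continuous_onI continuous_intros)+
  show "h \<in> borel_measurable \<gamma>" if "h \<in> borel_measurable borel"
    using that by (subst measurable_cong_sets[OF s refl]) (rule measurable_restrict_space1)
  show "space \<gamma> = I \<times> I" using sets_eq_imp_space_eq[OF s] by (simp add: space_restrict_space)
qed

lemma abs_pos_part_plus_abs_neg_part: "\<bar>pos_part f x\<bar> + \<bar>neg_part f x\<bar> = \<bar>f x\<bar>"
  by (auto simp: pos_part_def neg_part_def)

lemma measurable_pos_neg_part [measurable]:
  assumes "f \<in> borel_measurable M"
  shows "pos_part f \<in> borel_measurable M" "neg_part f \<in> borel_measurable M"
  using assms unfolding pos_part_def[abs_def] neg_part_def[abs_def] by auto

lemma integrable_pos_neg_part:
  assumes "integrable M g"
  shows "integrable M (pos_part g)" "integrable M (neg_part g)"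
  using assms unfolding pos_part_def[abs_def] neg_part_def[abs_def] by auto

lemma integrable_abs_times_infdist:
  fixes v :: "real \<Rightarrow> real"
  assumes v: "integrable lborel v" "\<And>x. x \<notin> I \<Longrightarrow> v x = 0"
    and I: "bounded I" and S: "S \<noteq> {}"
  shows "integrable lborel (\<lambda>x. \<bar>v x\<bar> * infdist x S)"
proof -
  obtain R where R: "\<And>x. x \<in> I \<Longrightarrow> \<bar>x\<bar> \<le> R" using I by (auto simp: bounded_iff)
  obtain s where s: "s \<in> S" using S by blast
  have [measurable]: "v \<in> borel_measurable borel" using v(1) by auto
  have [measurable]: "(\<lambda>x. infdist x S) \<in> borel_measurable borel"
    by (intro borel_measurable_continuous_onI continuous_intros)
  show ?thesis
  proof (rule Bochner_Integration.integrable_bound)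
    show "integrable lborel (\<lambda>x. (R + \<bar>s\<bar>) * v x)" using v by simp
    show "AE x in lborel. norm (\<bar>v x\<bar> * infdist x S) \<le> norm ((R + \<bar>s\<bar>) * v x)"
    proof (intro AE_I2)
      fix x
      show "norm (\<bar>v x\<bar> * infdist x S) \<le> norm ((R + \<bar>s\<bar>) * v x)"
      proof (cases "x \<in> I")
        case True
        then have "0 \<le> R" using R by force
        have "infdist x S \<le> R + \<bar>s\<bar>"
          using infdist_le[OF s, of x] R[OF True] by (auto simp: dist_real_def)
        then have "\<bar>v x\<bar> * infdist x S \<le> \<bar>v x\<bar> * (R + \<bar>s\<bar>)"
          by (intro mult_left_mono) auto
        then show ?thesis using \<open>0 \<le> R\<close> by (simp add: abs_mult infdist_nonneg mult.commute)
      qed (simp add: v(2))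
    qed
  qed measurable
qed

lemma powr_above_tangent:
  fixes t d p :: real
  assumes "0 \<le> t" "0 < d" "1 \<le> p"
  shows "d powr p + p * d powr (p - 1) * (t - d) \<le> t powr p"
proof (cases "t = 0")
  case True
  have "d powr p = d powr (p - 1) * d"
    using assms by (simp add: powr_mult_base mult.commute)
  then show ?thesis using assms True
    by (simp add: algebra_simps)
next
  case False
  have "p * d powr (p - 1) * (t - d) \<le> t powr p - d powr p"
  proof (rule convex_on_imp_above_tangent[where A = "{0<..}"])
    show "convex_on {0<..} (\<lambda>x. x powr p)" using powr_convex assms by blast
    show "((\<lambda>x. x powr p) has_field_derivative p * d powr (p - 1)) (at d within {0<..})"
      by (rule has_field_derivative_at_within, rule has_real_derivative_powr) (use assms in simp)
  qed (use assms False in \<open>auto simp: interior_open\<close>)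
  then show ?thesis by simp
qed

text \<open>A coupling moves mass from \<open>{g > 0}\<close> to \<open>{g < 0}\<close> across \<open>S\<close>, so \<open>\<bar>x - y\<bar>\<close> dominates
  \<open>infdist x S + infdist y S\<close>, whose integral depends only on the two marginals.  The tangent of
  \<open>t \<mapsto> t powr p\<close> at \<open>d\<close> then turns this bound on the mean distance into one on the \<open>p\<close>-th moment; it
  is sharp when all distances equal \<open>d\<close>.\<close>

lemma coupling_cost_lower_bound:
  fixes g :: "real \<Rightarrow> real"
  assumes I: "I \<in> sets borel" "bounded I"
    and g: "integrable lborel g" "\<And>x. x \<notin> I \<Longrightarrow> g x = 0"
    and S: "finite S" "S \<noteq> {}" "separates S g"
    and \<gamma>: "\<gamma> \<in> couplings I (density_measure I (pos_part g)) (density_measure I (neg_part g))"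
    and p: "1 \<le> p" and d: "0 < d"
  shows "d powr p * (LINT x|lborel. \<bar>pos_part g x\<bar>) + p * d powr (p - 1) *
      ((LINT x|lborel. \<bar>g x\<bar> * infdist x S) - d * (LINT x|lborel. \<bar>pos_part g x\<bar>))
    \<le> (LINT z|\<gamma>. \<bar>fst z - snd z\<bar> powr p)"
proof -
  let ?m = "LINT x|lborel. \<bar>pos_part g x\<bar>"
  have gm [measurable]: "g \<in> borel_measurable borel" using g(1) by auto
  have parts0: "\<And>x. x \<notin> I \<Longrightarrow> pos_part g x = 0" "\<And>x. x \<notin> I \<Longrightarrow> neg_part g x = 0"
    using g(2) by (auto simp: pos_part_def neg_part_def)
  have partm: "pos_part g \<in> borel_measurable borel" "neg_part g \<in> borel_measurable borel"
    by measurable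
  have d1: "distr \<gamma> (restrict_space borel I) fst = density_measure I (pos_part g)"
    and d2: "distr \<gamma> (restrict_space borel I) snd = density_measure I (neg_part g)"
    using \<gamma> by (auto simp: couplings_def)
  note proj = measurable_coupling_projections[OF \<gamma>]
  have fst_int: "(LINT z|\<gamma>. u (fst z)) = (LINT x|lborel. \<bar>pos_part g x\<bar> * u x)"
    if "u \<in> borel_measurable borel" for u :: "real \<Rightarrow> real"
  proof -
    have "(LINT z|\<gamma>. u (fst z)) = (LINT x|distr \<gamma> (restrict_space borel I) fst. u x)"
      by (rule integral_distr[symmetric]) (use proj that measurable_restrict_space1 in auto)
    then show ?thesis using integral_density_measure[OF I(1) partm(1) parts0(1) that] d1 by simp
  qed
  have snd_int: "(LINT z|\<gamma>. u (snd z)) = (LINT x|lborel. \<bar>neg_part g x\<bar> * u x)"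
    if "u \<in> borel_measurable borel" for u :: "real \<Rightarrow> real"
  proof -
    have "(LINT z|\<gamma>. u (snd z)) = (LINT x|distr \<gamma> (restrict_space borel I) snd. u x)"
      by (rule integral_distr[symmetric]) (use proj that measurable_restrict_space1 in auto)
    then show ?thesis using integral_density_measure[OF I(1) partm(2) parts0(2) that] d2 by simp
  qed
  have "emeasure \<gamma> (space \<gamma>) = emeasure (distr \<gamma> (restrict_space borel I) fst) I"
    using proj by (subst emeasure_distr) (auto simp: sets_restrict_space_iff I intro!: arg_cong[where f="emeasure \<gamma>"])
  also have "\<dots> = (\<integral>\<^sup>+x. ennreal \<bar>pos_part g x\<bar> * indicator I x \<partial>lborel)"
    unfolding d1 using I by (intro emeasure_density_measure partm parts0) (auto simp: sets_restrict_space_iff)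
  also have "\<dots> \<le> (\<integral>\<^sup>+x. ennreal (norm (g x)) \<partial>lborel)"
    by (intro nn_integral_mono) (auto simp: indicator_def pos_part_def intro!: ennreal_leI)
  also have "\<dots> < \<infinity>" using g(1) by (simp add: integrable_iff_bounded)
  finally interpret finite_measure \<gamma> by (intro finite_measureI) auto
  obtain R where R: "\<And>x. x \<in> I \<Longrightarrow> \<bar>x\<bar> \<le> R" using I(2) by (auto simp: bounded_iff)
  obtain s where s: "s \<in> S" using S by blast
  have idist: "infdist x S \<le> R + \<bar>s\<bar>" if "x \<in> I" for x
    using infdist_le[OF s, of x] R[OF that] by (auto simp: dist_real_def)
  have im [measurable]: "(\<lambda>x. infdist x S) \<in> borel_measurable borel"
    by (intro borel_measurable_continuous_onI continuous_intros)
  have contm: "(\<lambda>z::real\<times>real. \<bar>fst z - snd z\<bar>) \<in> borel_measurable borel"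
    "(\<lambda>z::real\<times>real. infdist (fst z) S) \<in> borel_measurable borel"
    "(\<lambda>z::real\<times>real. infdist (snd z) S) \<in> borel_measurable borel"
    by (intro borel_measurable_continuous_onI continuous_intros)+
  then have contm': "(\<lambda>z::real\<times>real. \<bar>fst z - snd z\<bar> powr p) \<in> borel_measurable borel"
    by measurable
  have dist_bound: "\<bar>fst z - snd z\<bar> \<le> 2 * R" if "z \<in> I \<times> I" for z
    using R[of "fst z"] R[of "snd z"] that by auto
  have int_dist: "integrable \<gamma> (\<lambda>z. \<bar>fst z - snd z\<bar>)"
    by (rule integrable_const_bound[where B="2 * R"])
       (use proj contm dist_bound in \<open>auto intro!: AE_I2\<close>)
  have int_powr: "integrable \<gamma> (\<lambda>z. \<bar>fst z - snd z\<bar> powr p)"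
    by (rule integrable_const_bound[where B="(2 * R) powr p"])
       (use proj contm' dist_bound p in \<open>auto intro!: AE_I2 powr_mono2\<close>)
  have int_fst: "integrable \<gamma> (\<lambda>z. infdist (fst z) S)"
    by (rule integrable_const_bound[where B="R + \<bar>s\<bar>"])
       (use proj contm idist in \<open>auto intro!: AE_I2 simp: infdist_nonneg\<close>)
  have int_snd: "integrable \<gamma> (\<lambda>z. infdist (snd z) S)"
    by (rule integrable_const_bound[where B="R + \<bar>s\<bar>"])
       (use proj contm idist in \<open>auto intro!: AE_I2 simp: infdist_nonneg\<close>)
  have "{x. 0 < g x} \<in> sets borel" "{x. g x < 0} \<in> sets borel" by measurable
  then have "AE x in distr \<gamma> (restrict_space borel I) fst. 0 < g x"
      "AE x in distr \<gamma> (restrict_space borel I) snd. g x < 0"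
    unfolding d1 d2 using I partm
    by (intro AE_density_measure; auto simp: pos_part_def neg_part_def max_def split: if_splits)+
  then have "AE z in \<gamma>. 0 < g (fst z)" "AE z in \<gamma>. g (snd z) < 0"
    using proj AE_distrD by blast+
  then have "AE z in \<gamma>. infdist (fst z) S + infdist (snd z) S \<le> \<bar>fst z - snd z\<bar>"
  proof eventually_elim
    case (elim z)
    then obtain w where w: "w \<in> S" "w \<in> closed_segment (fst z) (snd z)"
      using S by (auto simp: separates_def)
    have "infdist (fst z) S \<le> \<bar>fst z - w\<bar>" "infdist (snd z) S \<le> \<bar>snd z - w\<bar>"
      using infdist_le[OF w(1)] by (auto simp: dist_real_def)
    then show ?case using w(2) by (auto simp: closed_segment_eq_real_ivl split: if_splits)
  qed
  then have "(LINT z|\<gamma>. infdist (fst z) S + infdist (snd z) S) \<le> (LINT z|\<gamma>. \<bar>fst z - snd z\<bar>)"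
    by (intro integral_mono_AE Bochner_Integration.integrable_add int_fst int_snd int_dist)
  moreover have "(LINT z|\<gamma>. infdist (fst z) S + infdist (snd z) S) = (LINT x|lborel. \<bar>g x\<bar> * infdist x S)"
  proof -
    have int_part: "integrable lborel (\<lambda>x. \<bar>pos_part g x\<bar> * infdist x S)"
      "integrable lborel (\<lambda>x. \<bar>neg_part g x\<bar> * infdist x S)"
      using integrable_abs_times_infdist[OF integrable_pos_neg_part(1)[OF g(1)] parts0(1) I(2) S(2)]
        integrable_abs_times_infdist[OF integrable_pos_neg_part(2)[OF g(1)] parts0(2) I(2) S(2)] by auto
    have "(LINT z|\<gamma>. infdist (fst z) S + infdist (snd z) S) =
        (LINT x|lborel. \<bar>pos_part g x\<bar> * infdist x S) + (LINT x|lborel. \<bar>neg_part g x\<bar> * infdist x S)"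
      using int_fst int_snd fst_int[OF im] snd_int[OF im] by simp
    also have "\<dots> = (LINT x|lborel. \<bar>pos_part g x\<bar> * infdist x S + \<bar>neg_part g x\<bar> * infdist x S)"
      by (intro Bochner_Integration.integral_add[symmetric] int_part)
    also have "\<dots> = (LINT x|lborel. \<bar>g x\<bar> * infdist x S)"
      by (intro Bochner_Integration.integral_cong refl)
         (simp add: abs_pos_part_plus_abs_neg_part flip: distrib_right)
    finally show ?thesis .
  qed
  ultimately have D: "(LINT x|lborel. \<bar>g x\<bar> * infdist x S) \<le> (LINT z|\<gamma>. \<bar>fst z - snd z\<bar>)" by simp
  have mass: "measure \<gamma> (space \<gamma>) = ?m"
    using fst_int[of "\<lambda>_. 1"] by simp
  have "d powr p * ?m + p * d powr (p - 1) * ((LINT x|lborel. \<bar>g x\<bar> * infdist x S) - d * ?m)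
      \<le> d powr p * ?m + p * d powr (p - 1) * ((LINT z|\<gamma>. \<bar>fst z - snd z\<bar>) - d * ?m)"
    using D p by (intro add_left_mono mult_left_mono diff_right_mono) auto
  also have "\<dots> = (LINT z|\<gamma>. d powr p + p * d powr (p - 1) * (\<bar>fst z - snd z\<bar> - d))"
    using int_dist mass by (simp add: mult.commute)
  also have "\<dots> \<le> (LINT z|\<gamma>. \<bar>fst z - snd z\<bar> powr p)"
    using int_dist int_powr d p by (intro integral_mono powr_above_tangent) auto
  finally show ?thesis .
qed

text \<open>The normalized product measure is a coupling.  Nonemptiness matters for lower bounds on the
  Wasserstein distance: the infimum of an empty set of reals carries no information.\<close>

lemma couplings_nonempty:
  assumes "finite_measure \<mu>" "finite_measure \<nu>"
    and s: "sets \<mu> = sets (restrict_space borel I)" "sets \<nu> = sets (restrict_space borel I)"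
    and I: "I \<in> sets (borel :: real measure)"
    and mass: "emeasure \<mu> I = emeasure \<nu> I" "emeasure \<mu> I \<noteq> 0"
  shows "couplings I \<mu> \<nu> \<noteq> {}"
proof -
  interpret \<mu>: finite_measure \<mu> by fact
  interpret \<nu>: finite_measure \<nu> by fact
  interpret P: pair_sigma_finite \<mu> \<nu> ..
  let ?R = "restrict_space borel I" and ?R2 = "restrict_space (borel :: (real\<times>real) measure) (I \<times> I)"
  have sp: "space \<mu> = I" "space \<nu> = I"
    using s[THEN sets_eq_imp_space_eq] by (auto simp: space_restrict_space)
  define m where "m = emeasure \<mu> I"
  have m: "m \<noteq> 0" "m \<noteq> top" using mass \<mu>.emeasure_finite by (auto simp: m_def)
  then have mm: "inverse m * m = 1" "m * inverse m = 1"
    using ennreal_divide_self[of m] m by (auto simp: divide_ennreal_def mult.commute less_top)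
  define D where "D = density (\<mu> \<Otimes>\<^sub>M \<nu>) (\<lambda>_. inverse m)"
  have spD: "space D = I \<times> I" by (simp add: D_def space_pair_measure sp)
  have id: "(\<lambda>z. z) \<in> D \<rightarrow>\<^sub>M ?R2"
  proof (rule measurable_restrict_space2)
    have 1: "fst \<in> borel_measurable (\<mu> \<Otimes>\<^sub>M \<nu>)" "snd \<in> borel_measurable (\<mu> \<Otimes>\<^sub>M \<nu>)"
    proof -
      have i: "(\<lambda>x. x) \<in> ?R \<rightarrow>\<^sub>M borel" by (rule measurable_restrict_space1) simp
      have "(\<lambda>x. x) \<in> \<mu> \<rightarrow>\<^sub>M borel" "(\<lambda>x. x) \<in> \<nu> \<rightarrow>\<^sub>M borel"
        using i measurable_cong_sets[OF s(1) refl] measurable_cong_sets[OF s(2) refl] by blast+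
      from measurable_compose[OF measurable_fst[of \<mu> \<nu>] this(1)]
        measurable_compose[OF measurable_snd[of \<mu> \<nu>] this(2)]
      show "fst \<in> borel_measurable (\<mu> \<Otimes>\<^sub>M \<nu>)" "snd \<in> borel_measurable (\<mu> \<Otimes>\<^sub>M \<nu>)" by simp_all
    qed
    then have "(\<lambda>z. (fst z, snd z)) \<in> borel_measurable (\<mu> \<Otimes>\<^sub>M \<nu>)" by (rule borel_measurable_Pair)
    then show "(\<lambda>z. z) \<in> borel_measurable D" by (simp add: D_def)
  qed (simp add: spD)
  define \<gamma> where "\<gamma> = distr D ?R2 (\<lambda>z. z)"
  have fstm: "fst \<in> ?R2 \<rightarrow>\<^sub>M ?R" and sndm: "snd \<in> ?R2 \<rightarrow>\<^sub>M ?R"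
    by (rule measurable_restrict_space3;
        auto intro!: borel_measurable_continuous_onI continuous_intros)+
  have emD: "emeasure D (A \<times> B) = inverse m * (emeasure \<mu> A * emeasure \<nu> B)"
    if "A \<in> sets ?R" "B \<in> sets ?R" for A B
  proof -
    have "A \<times> B \<in> sets (\<mu> \<Otimes>\<^sub>M \<nu>)" using that s by auto
    then show ?thesis using that s
      by (simp add: D_def emeasure_density nn_integral_cmult_indicator \<nu>.emeasure_pair_measure_Times)
  qed
  have IR: "I \<in> sets ?R" using I by (simp add: sets_restrict_space_iff)
  have "distr \<gamma> ?R fst = \<mu>"
  proof (rule measure_eqI)
    fix B assume "B \<in> sets (distr \<gamma> ?R fst)"
    then have B: "B \<in> sets ?R" by simp
    then have "B \<subseteq> I" using sets.sets_into_space by (force simp: space_restrict_space)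
    then have "fst -` B \<inter> (I \<times> I) = B \<times> I" by auto
    then have "emeasure (distr \<gamma> ?R fst) B = emeasure D (B \<times> I)"
      unfolding \<gamma>_def using B fstm id
      by (simp add: distr_distr emeasure_distr spD comp_def)
    also have "\<dots> = emeasure \<mu> B"
      using emD[OF B IR] mass(1) mm by (simp add: m_def[symmetric] mult.left_commute)
    finally show "emeasure (distr \<gamma> ?R fst) B = emeasure \<mu> B" .
  qed (simp add: s)
  moreover have "distr \<gamma> ?R snd = \<nu>"
  proof (rule measure_eqI)
    fix B assume "B \<in> sets (distr \<gamma> ?R snd)"
    then have B: "B \<in> sets ?R" by simp
    then have "B \<subseteq> I" using sets.sets_into_space by (force simp: space_restrict_space)
    then have "snd -` B \<inter> (I \<times> I) = I \<times> B" by auto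
    then have "emeasure (distr \<gamma> ?R snd) B = emeasure D (I \<times> B)"
      unfolding \<gamma>_def using B sndm id
      by (simp add: distr_distr emeasure_distr spD comp_def)
    also have "\<dots> = emeasure \<nu> B"
      using emD[OF IR B] mm by (simp add: m_def[symmetric] mult.assoc[symmetric])
    finally show "emeasure (distr \<gamma> ?R snd) B = emeasure \<nu> B" .
  qed (simp add: s)
  ultimately have "\<gamma> \<in> couplings I \<mu> \<nu>" by (simp add: couplings_def \<gamma>_def)
  then show ?thesis by blast
qed

lemma wasserstein_le:
  assumes "\<gamma> \<in> couplings I \<mu> \<nu>"
  shows "wasserstein p I \<mu> \<nu> \<le> (LINT z|\<gamma>. \<bar>fst z - snd z\<bar> powr p) powr (1 / p)"
  unfolding wasserstein_def using assms
  by (intro cINF_lower bdd_belowI2[where m=0]) auto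

lemma wasserstein_ge:
  assumes "couplings I \<mu> \<nu> \<noteq> {}" "0 \<le> K" "0 < p"
    and "\<And>\<gamma>. \<gamma> \<in> couplings I \<mu> \<nu> \<Longrightarrow> K \<le> (LINT z|\<gamma>. \<bar>fst z - snd z\<bar> powr p)"
  shows "K powr (1 / p) \<le> wasserstein p I \<mu> \<nu>"
  unfolding wasserstein_def using assms by (intro cINF_greatest powr_mono2) auto

section \<open>The lower bound and its equality case\<close>

lemma AE_lborel_ex_greaterThanLessThan:
  fixes a b :: real
  assumes "AE x in lborel. P x" "a < b"
  obtains x where "a < x" "x < b" "P x"
proof -
  have nonnull: "\<not> (AE x in lborel. x \<notin> {a<..<b})"
    using assms(2) AE_iff_null_sets[of "{a<..<b}" lborel] by (auto simp: null_sets_def)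
  have "\<exists>x\<in>{a<..<b}. P x"
  proof (rule ccontr)
    assume no: "\<not> (\<exists>x\<in>{a<..<b}. P x)"
    have "AE x in lborel. x \<notin> {a<..<b}"
      using assms(1) by eventually_elim (use no in blast)
    then show False using nonnull by contradiction
  qed
  then show thesis using that by auto
qed

lemma separates_scale:
  assumes "s \<noteq> 0" "separates S f"
  shows "separates S (\<lambda>x. s * f x)"
  unfolding separates_def
proof (intro allI impI)
  fix x y assume *: "0 < s * f x" "s * f y < 0"
  show "\<exists>z\<in>S. z \<in> closed_segment x y"
  proof (cases "0 < s")
    case True
    then show ?thesis using * assms(2) by (auto simp: separates_def zero_less_mult_iff mult_less_0_iff)
  next
    case False
    then have "0 < f y" "f x < 0" using * assms(1) by (auto simp: zero_less_mult_iff mult_less_0_iff)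
    then show ?thesis using assms(2) unfolding separates_def closed_segment_commute[of x y] by blast
  qed
qed

text \<open>A segment from a positive point \<open>x\<close> to a negative point \<open>y\<close> that crosses \<open>z\<close> can be shortened to one
  that starts at the positive point \<open>u\<close> or \<open>v\<close> on the same side of \<open>z\<close> as \<open>y\<close>, and that one avoids
  \<open>z\<close>.\<close>

lemma separates_remove_false_node:
  assumes sep: "separates S g" and gz: "g z = 0"
    and nonneg: "\<And>x. \<bar>x - z\<bar> < d \<Longrightarrow> 0 \<le> g x"
    and u: "z - d < u" "u < z" "0 < g u" and v: "z < v" "v < z + d" "0 < g v"
  shows "separates (S - {z}) g"
  unfolding separates_def
proof (intro allI impI)
  fix x y assume xy: "0 < g x" "g y < 0"
  then obtain w where w: "w \<in> S" "w \<in> closed_segment x y" using sep by (auto simp: separates_def)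
  show "\<exists>w\<in>S - {z}. w \<in> closed_segment x y"
  proof (cases "w = z")
    case False
    then show ?thesis using w by blast
  next
    case True
    have "\<not> \<bar>y - z\<bar> < d" using nonneg[of y] xy by fastforce
    then consider "y \<le> z - d" | "z + d \<le> y" by linarith
    then show ?thesis
    proof cases
      case 1
      obtain w' where "w' \<in> S" "w' \<in> closed_segment u y"
        using sep u xy by (auto simp: separates_def)
      then show ?thesis using w True u 1
        by (intro bexI[of _ w']) (auto simp: closed_segment_eq_real_ivl split: if_splits)
    next
      case 2
      obtain w' where "w' \<in> S" "w' \<in> closed_segment v y"
        using sep v xy by (auto simp: separates_def)
      then show ?thesis using w True v 2
        by (intro bexI[of _ w']) (auto simp: closed_segment_eq_real_ivl split: if_splits)
    qed
  qed
qed

text \<open>The pointwise bound on \<open>\<bar>g\<bar>\<close> is available because \<open>g\<close> will be a representative of an admissible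
  function that is set to zero wherever the essential bound fails.\<close>

locale balanced_density =
  fixes I :: "real set" and g :: "real \<Rightarrow> real" and c c1 :: real
  assumes I_borel: "I \<in> sets borel" and I_bounded: "bounded I" and I_interval: "is_interval I"
    and g_integrable: "integrable lborel g" and g_outside: "\<And>x. x \<notin> I \<Longrightarrow> g x = 0"
    and g_le: "\<And>x. \<bar>g x\<bar> \<le> c" and c_pos: "0 < c"
    and g_mean: "(LINT x|lborel. g x) = 0" and g_norm: "(LINT x|lborel. \<bar>g x\<bar>) = c1"
    and c1_pos: "0 < c1"
begin

lemma g_measurable: "g \<in> borel_measurable borel"
  using g_integrable by auto

lemma parts_outside: "x \<notin> I \<Longrightarrow> pos_part g x = 0" "x \<notin> I \<Longrightarrow> neg_part g x = 0"
  using g_outside[of x] by (auto simp: pos_part_def neg_part_def)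

lemma mass_parts:
  "(LINT x|lborel. \<bar>pos_part g x\<bar>) = c1 / 2" "(LINT x|lborel. \<bar>neg_part g x\<bar>) = c1 / 2"
proof -
  have "(LINT x|lborel. \<bar>pos_part g x\<bar>) = (LINT x|lborel. (\<bar>g x\<bar> + g x) / 2)"
    by (intro Bochner_Integration.integral_cong) (auto simp: pos_part_def)
  then show "(LINT x|lborel. \<bar>pos_part g x\<bar>) = c1 / 2"
    using g_integrable g_mean g_norm by simp
  have "(LINT x|lborel. \<bar>neg_part g x\<bar>) = (LINT x|lborel. (\<bar>g x\<bar> - g x) / 2)"
    by (intro Bochner_Integration.integral_cong) (auto simp: neg_part_def)
  then show "(LINT x|lborel. \<bar>neg_part g x\<bar>) = c1 / 2"
    using g_integrable g_mean g_norm by simp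
qed

lemma emeasure_parts:
  "emeasure (density_measure I (pos_part g)) I = ennreal (c1 / 2)"
  "emeasure (density_measure I (neg_part g)) I = ennreal (c1 / 2)"
proof -
  have m: "pos_part g \<in> borel_measurable borel" "neg_part g \<in> borel_measurable borel"
    using g_measurable by measurable
  have *: "emeasure (density_measure I h) I = ennreal (LINT x|lborel. \<bar>h x\<bar>)"
    if h: "integrable lborel h" "\<And>x. x \<notin> I \<Longrightarrow> h x = 0" for h
  proof -
    have "emeasure (density_measure I h) I = (\<integral>\<^sup>+x. ennreal \<bar>h x\<bar> * indicator I x \<partial>lborel)"
      by (rule emeasure_density_measure) (use I_borel h in \<open>auto simp: sets_restrict_space_iff\<close>)
    also have "\<dots> = (\<integral>\<^sup>+x. ennreal \<bar>h x\<bar> \<partial>lborel)"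
      by (intro nn_integral_cong) (auto simp: indicator_def h)
    also have "\<dots> = ennreal (LINT x|lborel. \<bar>h x\<bar>)"
      by (rule nn_integral_eq_integral) (use h in auto)
    finally show ?thesis .
  qed
  show "emeasure (density_measure I (pos_part g)) I = ennreal (c1 / 2)"
    "emeasure (density_measure I (neg_part g)) I = ennreal (c1 / 2)"
    using *[OF integrable_pos_neg_part(1)[OF g_integrable]] *[OF integrable_pos_neg_part(2)[OF g_integrable]]
      parts_outside mass_parts by simp_all
qed

lemma couplings_parts_nonempty:
  "couplings I (density_measure I (pos_part g)) (density_measure I (neg_part g)) \<noteq> {}"
  using emeasure_parts I_borel c1_pos
  by (intro couplings_nonempty finite_measureI) auto

text \<open>At \<open>d = c1 / (2 * c * card S)\<close> the integral of this function is the amount by which the integral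
  of \<open>\<bar>g x\<bar> * infdist x S\<close> exceeds the bathtub bound \<open>d * (c1 / 2)\<close>.\<close>

definition excess :: "real set \<Rightarrow> real \<Rightarrow> real \<Rightarrow> real" where
  "excess S d x = (infdist x S - d) * \<bar>g x\<bar> + c * tents S d x"

lemma excess_nonneg:
  assumes "finite S" "S \<noteq> {}"
  shows "0 \<le> excess S d x"
  unfolding excess_def using assms g_le by (intro bathtub_nonneg) auto

lemma
  assumes S: "finite S" "S \<noteq> {}" and d: "0 < d"
  shows integrable_excess: "integrable lborel (excess S d)"
    and integral_excess: "(LINT x|lborel. excess S d x) =
      (LINT x|lborel. \<bar>g x\<bar> * infdist x S) - d * c1 + c * (real (card S) * d\<^sup>2)"
proof -
  have i: "integrable lborel (\<lambda>x. \<bar>g x\<bar> * infdist x S)"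
    using integrable_abs_times_infdist[OF g_integrable g_outside I_bounded S(2)] .
  note t = has_bochner_integral_tents[OF S(1) d, unfolded has_bochner_integral_iff]
  have eq: "excess S d = (\<lambda>x. \<bar>g x\<bar> * infdist x S - d * \<bar>g x\<bar> + c * tents S d x)"
    by (auto simp: excess_def algebra_simps)
  show "integrable lborel (excess S d)" unfolding eq using i t g_integrable by auto
  show "(LINT x|lborel. excess S d x) =
      (LINT x|lborel. \<bar>g x\<bar> * infdist x S) - d * c1 + c * (real (card S) * d\<^sup>2)"
    unfolding eq using i t g_integrable g_norm by simp
qed

lemma transport_cost_ge_excess:
  assumes S: "finite S" "S \<noteq> {}" "separates S g" and p: "1 \<le> p"
    and d: "d = c1 / (2 * c * real (card S))"
  shows "(d powr p * (c1 / 2) + p * d powr (p - 1) * (LINT x|lborel. excess S d x)) powr (1 / p)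
    \<le> transport_cost p I g"
  unfolding transport_cost_def
proof (rule wasserstein_ge)
  have N: "0 < real (card S)" using S by (simp add: card_gt_0_iff)
  then have d0: "0 < d" unfolding d using c1_pos c_pos by simp
  have "c * (real (card S) * d\<^sup>2) = d * c1 / 2"
    unfolding d using N c_pos by (simp add: field_simps power2_eq_square)
  then have ex: "(LINT x|lborel. excess S d x) = (LINT x|lborel. \<bar>g x\<bar> * infdist x S) - d * (c1 / 2)"
    using integral_excess[OF S(1,2) d0] by simp
  show "d powr p * (c1 / 2) + p * d powr (p - 1) * (LINT x|lborel. excess S d x)
      \<le> (LINT z|\<gamma>. \<bar>fst z - snd z\<bar> powr p)"
    if "\<gamma> \<in> couplings I (density_measure I (pos_part g)) (density_measure I (neg_part g))" for \<gamma>
    using coupling_cost_lower_bound[OF I_borel I_bounded g_integrable g_outside S that p d0]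
    unfolding mass_parts ex by simp
  have "0 \<le> (LINT x|lborel. excess S d x)"
    by (intro Bochner_Integration.integral_nonneg excess_nonneg S)
  then show "0 \<le> d powr p * (c1 / 2) + p * d powr (p - 1) * (LINT x|lborel. excess S d x)"
    using p c1_pos by simp
qed (use p couplings_parts_nonempty in auto)

lemma transport_cost_ge:
  assumes S: "finite S" "S \<noteq> {}" "separates S g" and p: "1 \<le> p"
    and d: "d = c1 / (2 * c * real (card S))"
  shows "(d powr p * (c1 / 2)) powr (1 / p) \<le> transport_cost p I g"
proof -
  have "0 \<le> (LINT x|lborel. excess S d x)"
    by (intro Bochner_Integration.integral_nonneg excess_nonneg S)
  then have "(d powr p * (c1 / 2)) powr (1 / p)
      \<le> (d powr p * (c1 / 2) + p * d powr (p - 1) * (LINT x|lborel. excess S d x)) powr (1 / p)"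
    using p c1_pos by (intro powr_mono2) auto
  also have "\<dots> \<le> transport_cost p I g" by (rule transport_cost_ge_excess[OF assms])
  finally show ?thesis .
qed

lemma separates_nonempty:
  assumes "separates S g"
  shows "S \<noteq> {}"
proof
  assume "S = {}"
  then have no: "\<not> (0 < g x \<and> g y < 0)" for x y using assms by (auto simp: separates_def)
  have "(\<forall>x. 0 \<le> g x) \<or> (\<forall>x. 0 \<le> - g x)" using no by (metis neg_0_le_iff_le not_le)
  then have "(LINT x|lborel. \<bar>g x\<bar>) = (LINT x|lborel. g x) \<or> (LINT x|lborel. \<bar>g x\<bar>) = (LINT x|lborel. - g x)"
    by (elim disjE) (auto intro!: Bochner_Integration.integral_cong)
  then show False using g_mean g_norm c1_pos by auto
qed

text \<open>Fewer points to cross mean a larger \<open>d\<close> and hence a strictly larger lower bound.\<close>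

lemma minimal_separating_set:
  assumes S: "finite S" "separates S g" and p: "1 \<le> p"
    and d: "d = c1 / (2 * c * real (card S))"
    and cost: "transport_cost p I g \<le> (d powr p * (c1 / 2)) powr (1 / p)"
    and z: "z \<in> S"
  shows "\<not> separates (S - {z}) g"
proof
  assume sep: "separates (S - {z}) g"
  then have ne: "S - {z} \<noteq> {}" by (rule separates_nonempty)
  then have lt: "0 < card (S - {z})" "card (S - {z}) < card S"
    using S(1) z card_Diff1_less[of S z] by (simp_all only: card_gt_0_iff finite_Diff simp_thms)
  define d' where "d' = c1 / (2 * c * real (card (S - {z})))"
  have "0 < d" "d < d'"
    using lt c_pos c1_pos unfolding d d'_def
    by (auto simp del: card_Diff_insert intro!: divide_strict_left_mono mult_pos_pos)
  then have "(d powr p * (c1 / 2)) powr (1 / p) < (d' powr p * (c1 / 2)) powr (1 / p)"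
    using p c1_pos by (intro powr_less_mono2 mult_strict_right_mono) auto
  also have "\<dots> \<le> transport_cost p I g"
    by (rule transport_cost_ge[OF _ ne sep p d'_def]) (use S in simp)
  finally show False using cost by simp
qed

lemma excess_AE_zero:
  assumes S: "finite S" "S \<noteq> {}" "separates S g" and p: "1 \<le> p"
    and d: "d = c1 / (2 * c * real (card S))"
    and cost: "transport_cost p I g \<le> (d powr p * (c1 / 2)) powr (1 / p)"
  shows "AE x in lborel. excess S d x = 0"
proof -
  let ?E = "LINT x|lborel. excess S d x"
  have N: "0 < real (card S)" using S by (simp add: card_gt_0_iff)
  then have d0: "0 < d" unfolding d using c1_pos c_pos by simp
  have E0: "0 \<le> ?E" by (intro Bochner_Integration.integral_nonneg excess_nonneg S)
  have "?E = 0"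
  proof (rule ccontr)
    assume "?E \<noteq> 0"
    then have "0 < p * d powr (p - 1) * ?E" using E0 p d0 by simp
    then have "(d powr p * (c1 / 2)) powr (1 / p)
        < (d powr p * (c1 / 2) + p * d powr (p - 1) * ?E) powr (1 / p)"
      using p c1_pos by (intro powr_less_mono2) auto
    also have "\<dots> \<le> transport_cost p I g" by (rule transport_cost_ge_excess[OF S p d])
    finally show False using cost by simp
  qed
  then show ?thesis
    using integral_nonneg_eq_0_iff_AE[OF integrable_excess[OF S(1,2) d0]] excess_nonneg[OF S(1,2)]
    by simp
qed

text \<open>Almost every point satisfies the equality case of the bathtub inequality.  Since \<open>S\<close> has no point
  inside a half cell, \<open>g\<close> cannot change its sign there; equal signs on the two halves of a cell would
  make its midpoint redundant, against \<open>minimal_separating_set\<close>.  Requiring \<open>g = 0\<close> on \<open>S\<close> makes the sign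
  condition hold on the whole cell, midpoint included.\<close>

lemma minimizer_structure:
  assumes S: "finite S" "separates S g" and gS: "\<And>z. z \<in> S \<Longrightarrow> g z = 0" and p: "1 \<le> p"
    and d: "d = c1 / (2 * c * real (card S))"
    and cost: "transport_cost p I g \<le> (d powr p * (c1 / 2)) powr (1 / p)"
  shows "\<And>z. z \<in> S \<Longrightarrow> {z - d<..<z + d} \<subseteq> I"
    and "\<And>z. z \<in> S \<Longrightarrow> \<exists>s\<in>{c, - c}. AE x in lborel.
      (x \<in> {z - d<..<z} \<longrightarrow> g x = s) \<and> (x \<in> {z<..<z + d} \<longrightarrow> g x = - s)"
    and "AE x in lborel. x \<notin> (\<Union>z\<in>S. {z - d<..<z + d}) \<longrightarrow> g x = 0"
proof -
  have ne: "S \<noteq> {}" using separates_nonempty S by blast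
  have N: "0 < real (card S)" using S ne by (simp add: card_gt_0_iff)
  then have d0: "0 < d" unfolding d using c1_pos c_pos by simp
  have AE0: "AE x in lborel. excess S d x = 0" by (rule excess_AE_zero[OF S(1) ne S(2) p d cost])
  have eq: "excess S d x = 0 \<Longrightarrow> infdist x S > d \<Longrightarrow> \<bar>g x\<bar> = 0"
    "excess S d x = 0 \<Longrightarrow> z \<in> S \<Longrightarrow> \<bar>x - z\<bar> < d \<Longrightarrow> \<bar>g x\<bar> = c"
    "excess S d x = 0 \<Longrightarrow> z \<in> S \<Longrightarrow> z' \<in> S \<Longrightarrow> \<bar>x - z\<bar> < d \<Longrightarrow> \<bar>x - z'\<bar> < d \<Longrightarrow> z = z'"
    for x z z'
    unfolding excess_def
    using bathtub_equality[OF S(1) ne abs_ge_zero g_le c_pos, of x d x] by blast+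
  \<comment> \<open>the tents of two closer points would overlap on an interval, hence on a non-null set\<close>
  have far: "2 * d \<le> \<bar>z - z'\<bar>" if "z \<in> S" "z' \<in> S" "z \<noteq> z'" for z z'
  proof (rule ccontr)
    assume "\<not> 2 * d \<le> \<bar>z - z'\<bar>"
    then have "max (z - d) (z' - d) < min (z + d) (z' + d)" using d0 by (auto simp: abs_if split: if_splits)
    from AE_lborel_ex_greaterThanLessThan[OF AE0 this] obtain x
      where "max (z - d) (z' - d) < x" "x < min (z + d) (z' + d)" "excess S d x = 0" .
    then show False using eq(3)[of x z z'] that by (auto simp: abs_less_iff)
  qed
  show "{z - d<..<z + d} \<subseteq> I" if "z \<in> S" for z
  proof
    fix x assume x: "x \<in> {z - d<..<z + d}"
    then have "z - d < x" "x < z + d" by auto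
    then obtain u v where u: "z - d < u" "u < x" "excess S d u = 0"
      and v: "x < v" "v < z + d" "excess S d v = 0"
      using AE_lborel_ex_greaterThanLessThan[OF AE0] by metis
    then have "\<bar>g u\<bar> = c" "\<bar>g v\<bar> = c" using eq(2)[of u z] eq(2)[of v z] that by (auto simp: abs_if)
    then have "g u \<noteq> 0" "g v \<noteq> 0" using c_pos by auto
    then have "u \<in> I" "v \<in> I" using g_outside by blast+
    then show "x \<in> I" using mem_is_interval_1_I[OF I_interval, of u v x] u v by auto
  qed
  have one_sign: "(\<forall>x. a < x \<and> x < b \<longrightarrow> 0 \<le> g x) \<or> (\<forall>x. a < x \<and> x < b \<longrightarrow> g x \<le> 0)"
    if "S \<inter> {a<..<b} = {}" for a b
  proof (rule ccontr)
    assume "\<not> ?thesis"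
    then obtain x y where "a < x" "x < b" "g x < 0" "a < y" "y < b" "0 < g y"
      by (auto simp: not_le)
    moreover from this obtain w where "w \<in> S" "w \<in> closed_segment y x"
      using S by (auto simp: separates_def)
    ultimately have "w \<in> S \<inter> {a<..<b}" by (auto simp: closed_segment_eq_real_ivl split: if_splits)
    then show False using that by blast
  qed
  have val: "\<exists>s\<in>{c, - c}. (\<forall>x. a < x \<and> x < b \<longrightarrow> 0 \<le> s * g x) \<and> (AE x in lborel. a < x \<and> x < b \<longrightarrow> g x = s)"
    if "S \<inter> {a<..<b} = {}" "z \<in> S" "\<And>x. a < x \<Longrightarrow> x < b \<Longrightarrow> \<bar>x - z\<bar> < d" for a b z
  proof -
    have AEc: "AE x in lborel. a < x \<and> x < b \<longrightarrow> \<bar>g x\<bar> = c"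
      using AE0 by eventually_elim (use eq(2) that in blast)
    from one_sign[OF that(1)] show ?thesis
    proof
      assume pos: "\<forall>x. a < x \<and> x < b \<longrightarrow> 0 \<le> g x"
      have "AE x in lborel. a < x \<and> x < b \<longrightarrow> g x = c"
        using AEc by eventually_elim (use pos in auto)
      then show ?thesis using pos c_pos by (intro bexI[of _ c]) auto
    next
      assume neg: "\<forall>x. a < x \<and> x < b \<longrightarrow> g x \<le> 0"
      have "AE x in lborel. a < x \<and> x < b \<longrightarrow> g x = - c"
        using AEc by eventually_elim (use neg in force)
      then show ?thesis using neg c_pos by (intro bexI[of _ "- c"]) (auto simp: mult_nonneg_nonpos)
    qed
  qed
  show "\<exists>s\<in>{c, - c}. AE x in lborel.
      (x \<in> {z - d<..<z} \<longrightarrow> g x = s) \<and> (x \<in> {z<..<z + d} \<longrightarrow> g x = - s)" if z: "z \<in> S" for z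
  proof -
    have empty: "S \<inter> {z - d<..<z} = {}" "S \<inter> {z<..<z + d} = {}"
      using far[OF z] d0 by fastforce+
    have near: "\<And>x. z - d < x \<Longrightarrow> x < z \<Longrightarrow> \<bar>x - z\<bar> < d" "\<And>x. z < x \<Longrightarrow> x < z + d \<Longrightarrow> \<bar>x - z\<bar> < d"
      by auto
    obtain s where s: "s \<in> {c, - c}" "\<forall>x. z - d < x \<and> x < z \<longrightarrow> 0 \<le> s * g x"
      "AE x in lborel. z - d < x \<and> x < z \<longrightarrow> g x = s"
      using val[OF empty(1) z near(1)] by blast
    obtain t where t: "t \<in> {c, - c}" "\<forall>x. z < x \<and> x < z + d \<longrightarrow> 0 \<le> t * g x"
      "AE x in lborel. z < x \<and> x < z + d \<longrightarrow> g x = t"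
      using val[OF empty(2) z near(2)] by blast
    have "t \<noteq> s"
    proof
      assume ts: "t = s"
      have nonneg: "0 \<le> s * g x" if "\<bar>x - z\<bar> < d" for x
        using s(2) t(2) ts gS[OF z] that by (cases x z rule: linorder_cases) auto
      have "z - d < z" "z < z + d" using d0 by auto
      then obtain u v where "z - d < u" "u < z" "g u = s" "z < v" "v < z + d" "g v = s"
        using AE_lborel_ex_greaterThanLessThan[OF s(3), of "z - d" z]
          AE_lborel_ex_greaterThanLessThan[OF t(3), of z "z + d"] ts by metis
      then have "separates (S - {z}) (\<lambda>x. s * g x)"
        using c_pos s(1) S(2) gS[OF z] nonneg
        by (intro separates_remove_false_node[where u=u and v=v and d=d] separates_scale) auto
      moreover have "s \<noteq> 0" using s(1) c_pos by auto
      ultimately have "separates (S - {z}) g"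
        using separates_scale[of "inverse s" "S - {z}" "\<lambda>x. s * g x"] by (simp flip: mult.assoc)
      then show False using minimal_separating_set[OF S p d cost z] by simp
    qed
    then have ts: "t = - s" using s(1) t(1) by auto
    from s(3) t(3)
    have "AE x in lborel. (x \<in> {z - d<..<z} \<longrightarrow> g x = s) \<and> (x \<in> {z<..<z + d} \<longrightarrow> g x = - s)"
      by eventually_elim (use ts in auto)
    then show ?thesis using s(1) by blast
  qed
  \<comment> \<open>at distance exactly \<open>d\<close> the bathtub inequality says nothing, but there are finitely many such points\<close>
  have "AE x in lborel. \<forall>w\<in>(\<lambda>z. z - d) ` S \<union> (\<lambda>z. z + d) ` S. x \<noteq> w"
    using S(1) by (intro AE_finite_allI AE_lborel_singleton) auto
  with AE0 show "AE x in lborel. x \<notin> (\<Union>z\<in>S. {z - d<..<z + d}) \<longrightarrow> g x = 0"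
  proof eventually_elim
    case (elim x)
    show ?case
    proof
      assume out: "x \<notin> (\<Union>z\<in>S. {z - d<..<z + d})"
      obtain z where z: "z \<in> S" "infdist x S = \<bar>x - z\<bar>" using infdist_real_attained S(1) ne .
      then have "x \<noteq> z - d" "x \<noteq> z + d" using elim(2) by auto
      moreover have "x \<notin> {z - d<..<z + d}" using out z by blast
      ultimately have "d < infdist x S" using z by auto
      then show "g x = 0" using eq(1) elim(1) by auto
    qed
  qed
qed

end

section \<open>Step profiles and the shift coupling\<close>

lemma AE_lebesgue_on_iff_lborel:
  assumes "I \<in> sets (borel :: real measure)"
  shows "(AE x in lebesgue_on I. P x) \<longleftrightarrow> (AE x in lborel. x \<in> I \<longrightarrow> P x)"
proof -
  have "I \<in> sets lebesgue" using assms by (simp add: sets_completionI_sets)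
  then have "(AE x in lebesgue_on I. P x) \<longleftrightarrow> (AE x in lebesgue. x \<in> I \<longrightarrow> P x)"
    by (intro AE_restrict_space_iff) simp
  also have "\<dots> \<longleftrightarrow> (AE x in lborel. x \<in> I \<longrightarrow> P x)" by (rule AE_completion_iff)
  finally show ?thesis .
qed

text \<open>The half of the cell around \<open>z\<close> from which moving by \<open>d\<close> in the direction \<open>s = \<plusminus>1\<close> leads across \<open>z\<close> to
  the other half.  The formula is symmetric in the two directions, so both are shifted alike.\<close>

definition half_cell :: "real \<Rightarrow> real \<Rightarrow> real \<Rightarrow> real set" where
  "half_cell d s z = {x. 0 < s * (z - x) \<and> s * (z - x) < d}"

lemma half_cell_simps:
  "half_cell d 1 z = {z - d<..<z}" "half_cell d (- 1) z = {z<..<z + d}"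
  by (auto simp: half_cell_def)

lemma half_cell_cases:
  assumes "s = 1 \<or> s = - 1"
  shows "half_cell d s z \<union> half_cell d (- s) z \<subseteq> {z - d<..<z + d}"
    "{z - d<..<z + d} - {z} \<subseteq> half_cell d s z \<union> half_cell d (- s) z"
    "half_cell d s z \<inter> half_cell d (- s) z = {}" "half_cell d s z \<in> sets borel"
    "0 < d \<Longrightarrow> emeasure lborel (half_cell d s z) = ennreal d"
  using assms by (auto simp: half_cell_simps)

lemma half_cell_shift:
  assumes "s = 1 \<or> s = - 1"
  shows "x + s * d \<in> half_cell d (- s) z \<longleftrightarrow> x \<in> half_cell d s z"
  using assms by (auto simp: half_cell_simps)

locale step_profile =
  fixes I S :: "real set" and d c :: real and \<sigma> :: "real \<Rightarrow> real"
  assumes I_borel: "I \<in> sets borel"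
    and S_finite: "finite S" and d_pos: "0 < d" and c_pos: "0 < c"
    and cells_subset: "\<And>z. z \<in> S \<Longrightarrow> {z - d<..<z + d} \<subseteq> I"
    and cells_disjoint: "\<And>z z'. z \<in> S \<Longrightarrow> z' \<in> S \<Longrightarrow> z \<noteq> z' \<Longrightarrow> 2 * d \<le> \<bar>z - z'\<bar>"
    and \<sigma>: "\<And>z. \<sigma> z = 1 \<or> \<sigma> z = - 1"
begin

definition source :: "real set" where "source = (\<Union>z\<in>S. half_cell d (\<sigma> z) z)"
definition sink :: "real set" where "sink = (\<Union>z\<in>S. half_cell d (- \<sigma> z) z)"
definition profile :: "real \<Rightarrow> real" where "profile x = c * (indicator source x - indicator sink x)"
definition shift :: "real \<Rightarrow> real" where
  "shift x = x + (\<Sum>z\<in>S. \<sigma> z * d * indicator (half_cell d (\<sigma> z) z) x)"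

lemma same_cell:
  assumes "z \<in> S" "z' \<in> S" "x \<in> {z - d<..<z + d}" "x \<in> {z' - d<..<z' + d}"
  shows "z = z'"
proof (rule ccontr)
  assume "z \<noteq> z'"
  then have "2 * d \<le> \<bar>z - z'\<bar>" using cells_disjoint assms(1,2) by blast
  then show False using assms(3,4) by (simp add: abs_if split: if_splits)
qed

lemma \<sigma>': "- \<sigma> z = 1 \<or> - \<sigma> z = - 1" using \<sigma>[of z] by auto

lemma in_half_cell: "x \<in> half_cell d (\<sigma> z) z \<Longrightarrow> x \<in> {z - d<..<z + d}"
  "x \<in> half_cell d (- \<sigma> z) z \<Longrightarrow> x \<in> {z - d<..<z + d}"
  using half_cell_cases(1)[OF \<sigma>] by blast+

lemma source_sink_subset: "source \<subseteq> I" "sink \<subseteq> I"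
  using cells_subset in_half_cell unfolding source_def sink_def by blast+

lemma source_sink_disjoint: "source \<inter> sink = {}"
proof -
  have False if "x \<in> source" "x \<in> sink" for x
  proof -
    obtain z z' where z: "z \<in> S" "x \<in> half_cell d (\<sigma> z) z" and z': "z' \<in> S" "x \<in> half_cell d (- \<sigma> z') z'"
      using \<open>x \<in> source\<close> \<open>x \<in> sink\<close> by (auto simp: source_def sink_def)
    then have "z = z'" using same_cell in_half_cell by blast
    then show False using z z' half_cell_cases(3)[OF \<sigma>[of z]] by blast
  qed
  then show ?thesis by blast
qed

lemma source_sink_borel [measurable]: "source \<in> sets borel" "sink \<in> sets borel"
  unfolding source_def sink_def using S_finite half_cell_cases(4)[OF \<sigma>] half_cell_cases(4)[OF \<sigma>']
  by (auto intro!: sets.finite_UN)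

lemma profile_borel: "profile \<in> borel_measurable borel"
  unfolding profile_def[abs_def] by measurable

lemma indicator_source_sink:
  "(indicator source x :: 'a::{comm_monoid_add,zero_neq_one}) = (\<Sum>z\<in>S. indicator (half_cell d (\<sigma> z) z) x)"
  "(indicator sink x :: 'a) = (\<Sum>z\<in>S. indicator (half_cell d (- \<sigma> z) z) x)"
proof -
  have "disjoint_family_on (\<lambda>z. half_cell d (\<sigma> z) z) S" "disjoint_family_on (\<lambda>z. half_cell d (- \<sigma> z) z) S"
    unfolding disjoint_family_on_def using same_cell in_half_cell by blast+
  then show "(indicator source x :: 'a::{comm_monoid_add,zero_neq_one}) = (\<Sum>z\<in>S. indicator (half_cell d (\<sigma> z) z) x)"
    "(indicator sink x :: 'a) = (\<Sum>z\<in>S. indicator (half_cell d (- \<sigma> z) z) x)"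
    unfolding source_def sink_def using S_finite by (simp_all add: indicator_UN_disjoint)
qed

lemma abs_parts:
  "\<bar>pos_part profile x\<bar> = c * indicator source x" "\<bar>neg_part profile x\<bar> = c * indicator sink x"
  "\<bar>profile x\<bar> = c * indicator (source \<union> sink) x"
  using source_sink_disjoint c_pos
  by (auto simp: pos_part_def neg_part_def profile_def indicator_def max_def)

lemma profile_outside:
  "x \<notin> I \<Longrightarrow> profile x = 0" "x \<notin> I \<Longrightarrow> pos_part profile x = 0" "x \<notin> I \<Longrightarrow> neg_part profile x = 0"
  using source_sink_subset by (auto simp: profile_def pos_part_def neg_part_def indicator_def)

lemma shift_cell:
  assumes "z \<in> S" "x \<in> half_cell d (\<sigma> z) z"
  shows "shift x = x + \<sigma> z * d"
proof -
  have "x \<notin> half_cell d (\<sigma> z') z'" if "z' \<in> S - {z}" for z'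
    using that assms same_cell[of z z' x] in_half_cell(1)[of x z] in_half_cell(1)[of x z'] by blast
  then have "(\<Sum>z\<in>S. \<sigma> z * d * indicator (half_cell d (\<sigma> z) z) x) = \<sigma> z * d"
    using assms S_finite by (subst sum.remove[of _ z]) auto
  then show ?thesis by (simp add: shift_def)
qed

lemma shift_outside: "x \<notin> source \<Longrightarrow> shift x = x"
  by (auto simp: shift_def source_def indicator_def intro!: sum.neutral)

lemma shift_in:
  assumes "x \<in> I"
  shows "shift x \<in> I"
proof (cases "x \<in> source")
  case True
  then obtain z where z: "z \<in> S" "x \<in> half_cell d (\<sigma> z) z" by (auto simp: source_def)
  then have "shift x \<in> half_cell d (- \<sigma> z) z"
    using shift_cell[OF z] half_cell_shift[OF \<sigma>[of z], of x d z] by simp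
  then have "shift x \<in> sink" using z by (auto simp: sink_def)
  then show ?thesis using source_sink_subset by blast
qed (simp add: shift_outside assms)

lemma shift_borel: "shift \<in> borel_measurable borel"
  unfolding shift_def[abs_def] using half_cell_cases(4)[OF \<sigma>] by measurable

lemma shift_distance: "x \<in> source \<Longrightarrow> \<bar>x - shift x\<bar> = d"
proof -
  assume "x \<in> source"
  then obtain z where z: "z \<in> S" "x \<in> half_cell d (\<sigma> z) z" by (auto simp: source_def)
  then show ?thesis using shift_cell[OF z] \<sigma>[of z] d_pos by auto
qed

text \<open>The shift carries the uniform measure on the source to the uniform measure on the sink: on each half
  cell it is a translation onto the opposite half.\<close>

lemma nn_integral_shift:
  assumes u [measurable]: "u \<in> borel_measurable borel"
  shows "(\<integral>\<^sup>+x. indicator source x * u (shift x) \<partial>lborel) = (\<integral>\<^sup>+x. indicator sink x * u x \<partial>lborel)"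
proof -
  note [measurable] = half_cell_cases(4)[OF \<sigma>] half_cell_cases(4)[OF \<sigma>']
  have "(\<integral>\<^sup>+x. indicator source x * u (shift x) \<partial>lborel)
      = (\<integral>\<^sup>+x. (\<Sum>z\<in>S. indicator (half_cell d (\<sigma> z) z) x * u (x + \<sigma> z * d)) \<partial>lborel)"
  proof (intro nn_integral_cong)
    fix x
    have "indicator source x * u (shift x) = (\<Sum>z\<in>S. indicator (half_cell d (\<sigma> z) z) x * u (shift x))"
      unfolding indicator_source_sink by (simp add: sum_distrib_right)
    also have "\<dots> = (\<Sum>z\<in>S. indicator (half_cell d (\<sigma> z) z) x * u (x + \<sigma> z * d))"
      by (intro sum.cong refl) (auto simp: indicator_def shift_cell)
    finally show "indicator source x * u (shift x) = \<dots>" .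
  qed
  also have "\<dots> = (\<Sum>z\<in>S. \<integral>\<^sup>+x. indicator (half_cell d (\<sigma> z) z) x * u (x + \<sigma> z * d) \<partial>lborel)"
    by (intro nn_integral_sum) measurable
  also have "\<dots> = (\<Sum>z\<in>S. \<integral>\<^sup>+x. indicator (half_cell d (- \<sigma> z) z) x * u x \<partial>lborel)"
  proof (intro sum.cong refl)
    fix z
    have m: "(\<lambda>x. indicator (half_cell d (- \<sigma> z) z) x * u x) \<in> borel_measurable borel" by measurable
    have "(\<integral>\<^sup>+x. indicator (half_cell d (- \<sigma> z) z) x * u x \<partial>lborel)
        = (\<integral>\<^sup>+x. indicator (half_cell d (- \<sigma> z) z) (\<sigma> z * d + 1 * x) * u (\<sigma> z * d + 1 * x) \<partial>lborel)"
      using nn_integral_real_affine[OF m, of 1 "\<sigma> z * d"] by (simp only: abs_one ennreal_1 mult_1_left zero_neq_one not_False_eq_True one_neq_zero)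
    also have "\<dots> = (\<integral>\<^sup>+x. indicator (half_cell d (\<sigma> z) z) x * u (x + \<sigma> z * d) \<partial>lborel)"
      using half_cell_shift[OF \<sigma>[of z], of _ d z]
      by (intro nn_integral_cong) (auto simp: indicator_def add.commute)
    finally show "(\<integral>\<^sup>+x. indicator (half_cell d (\<sigma> z) z) x * u (x + \<sigma> z * d) \<partial>lborel)
      = (\<integral>\<^sup>+x. indicator (half_cell d (- \<sigma> z) z) x * u x \<partial>lborel)" by simp
  qed
  also have "\<dots> = (\<integral>\<^sup>+x. (\<Sum>z\<in>S. indicator (half_cell d (- \<sigma> z) z) x * u x) \<partial>lborel)"
    by (intro nn_integral_sum[symmetric]) measurable
  also have "\<dots> = (\<integral>\<^sup>+x. indicator sink x * u x \<partial>lborel)"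
    unfolding indicator_source_sink by (simp add: sum_distrib_right)
  finally show ?thesis .
qed

lemma emeasure_source_sink: "emeasure lborel source = ennreal (real (card S) * d)" "emeasure lborel sink = ennreal (real (card S) * d)"
proof -
  note [measurable] = half_cell_cases(4)[OF \<sigma>] half_cell_cases(4)[OF \<sigma>']
  have "emeasure lborel source = (\<integral>\<^sup>+x. indicator source x \<partial>lborel)" by simp
  also have "\<dots> = (\<Sum>z\<in>S. \<integral>\<^sup>+x. indicator (half_cell d (\<sigma> z) z) x \<partial>lborel)"
    unfolding indicator_source_sink by (intro nn_integral_sum) measurable
  also have "\<dots> = ennreal (real (card S) * d)"
    using half_cell_cases(4,5)[OF \<sigma>] d_pos by (simp add: ennreal_mult' ennreal_of_nat_eq_real_of_nat)
  finally show "emeasure lborel source = ennreal (real (card S) * d)" .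
  then show "emeasure lborel sink = ennreal (real (card S) * d)"
    using nn_integral_shift[of "\<lambda>_. 1"] by simp
qed

lemma measure_source_sink: "measure lborel source = real (card S) * d" "measure lborel sink = real (card S) * d"
  using emeasure_source_sink d_pos by (simp_all add: measure_def)

lemma integrable_indicator_source_sink: "integrable lborel (indicator source :: real \<Rightarrow> real)" "integrable lborel (indicator sink :: real \<Rightarrow> real)"
  by (simp_all add: emeasure_source_sink less_top[symmetric])

lemma integral_profile: "(LINT x|lborel. profile x) = 0"
proof -
  have "(LINT x|lborel. profile x) = c * ((LINT x|lborel. indicator source x) - (LINT x|lborel. indicator sink x))"
    unfolding profile_def using integrable_indicator_source_sink
    by (simp only: Bochner_Integration.integral_mult_right_zero Bochner_Integration.integral_diff)
  then show ?thesis using measure_source_sink by simp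
qed

lemma nn_integral_profile: "(\<integral>\<^sup>+x. ennreal \<bar>profile x\<bar> \<partial>lborel) = ennreal (2 * c * d * real (card S))"
proof -
  have "(\<integral>\<^sup>+x. ennreal \<bar>profile x\<bar> \<partial>lborel) = (\<integral>\<^sup>+x. ennreal c * indicator (source \<union> sink) x \<partial>lborel)"
    unfolding abs_parts using c_pos by (intro nn_integral_cong) (auto simp: indicator_def)
  also have "\<dots> = ennreal c * emeasure lborel (source \<union> sink)" by (simp add: nn_integral_cmult)
  also have "emeasure lborel (source \<union> sink) = ennreal (real (card S) * d) + ennreal (real (card S) * d)"
    using source_sink_disjoint emeasure_source_sink by (subst plus_emeasure[symmetric]) auto
  also have "\<dots> = ennreal (real (card S) * d + real (card S) * d)"
    using d_pos by (intro ennreal_plus[symmetric]) auto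
  also have "ennreal c * \<dots> = ennreal (2 * c * d * real (card S))"
    using c_pos d_pos by (simp add: ennreal_mult'[symmetric] algebra_simps)
  finally show ?thesis .
qed

text \<open>The coupling is the push-forward of the positive part under \<open>x \<mapsto> (x, shift x)\<close>.\<close>

lemma transport_cost_profile_le:
  "transport_cost p I profile \<le> (d powr p * (c * d * real (card S))) powr (1 / p)"
proof -
  let ?\<mu> = "density_measure I (pos_part profile)" and ?\<nu> = "density_measure I (neg_part profile)"
  let ?R = "restrict_space borel I" and ?R2 = "restrict_space (borel :: (real\<times>real) measure) (I \<times> I)"
  have parts [measurable]: "pos_part profile \<in> borel_measurable borel" "neg_part profile \<in> borel_measurable borel"
    using profile_borel by measurable
  note [measurable] = shift_borel
  define \<gamma> where "\<gamma> = distr ?\<mu> ?R2 (\<lambda>x. (x, shift x))"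
  have "(\<lambda>x. (x, shift x)) \<in> ?R \<rightarrow>\<^sub>M ?R2"
    by (rule measurable_restrict_space3) (use shift_in in auto)
  then have m: "(\<lambda>x. (x, shift x)) \<in> ?\<mu> \<rightarrow>\<^sub>M ?R2"
    by (simp cong: measurable_cong_sets)
  have fstm: "fst \<in> ?R2 \<rightarrow>\<^sub>M ?R" and sndm: "snd \<in> ?R2 \<rightarrow>\<^sub>M ?R"
    by (rule measurable_restrict_space3;
        auto intro!: borel_measurable_continuous_onI continuous_intros)+
  have "distr \<gamma> ?R fst = distr ?\<mu> ?R (\<lambda>x. x)"
    unfolding \<gamma>_def using fstm m by (simp add: distr_distr comp_def)
  also have "\<dots> = ?\<mu>" by (rule distr_id2) simp
  finally have 1: "distr \<gamma> ?R fst = ?\<mu>" .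
  have shm: "shift \<in> ?\<mu> \<rightarrow>\<^sub>M ?R"
    using measurable_compose[OF m sndm] by simp
  have "distr \<gamma> ?R snd = distr ?\<mu> ?R shift"
    unfolding \<gamma>_def using sndm m by (simp add: distr_distr comp_def)
  also have "\<dots> = ?\<nu>"
  proof (rule measure_eqI)
    fix B assume "B \<in> sets (distr ?\<mu> ?R shift)"
    then have B: "B \<in> sets ?R" by simp
    then have Bb [measurable]: "B \<in> sets borel" using I_borel by (auto simp: sets_restrict_space_iff)
    have "emeasure (distr ?\<mu> ?R shift) B = (\<integral>\<^sup>+x. indicator B x \<partial>distr ?\<mu> ?R shift)"
      using B by simp
    also have "\<dots> = (\<integral>\<^sup>+x. indicator B (shift x) \<partial>?\<mu>)"
      using B shm by (intro nn_integral_distr) auto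
    also have "\<dots> = (\<integral>\<^sup>+x. ennreal \<bar>pos_part profile x\<bar> * indicator B (shift x) \<partial>lborel)"
      by (rule nn_integral_density_measure) (use I_borel parts profile_outside in auto)
    also have "\<dots> = (\<integral>\<^sup>+x. ennreal c * (indicator source x * indicator B (shift x)) \<partial>lborel)"
      unfolding abs_parts using c_pos by (intro nn_integral_cong) (auto simp: indicator_def)
    also have "\<dots> = ennreal c * (\<integral>\<^sup>+x. indicator source x * indicator B (shift x) \<partial>lborel)"
      by (intro nn_integral_cmult) measurable
    also have "\<dots> = ennreal c * (\<integral>\<^sup>+x. indicator sink x * indicator B x \<partial>lborel)"
      by (subst nn_integral_shift) auto
    also have "\<dots> = (\<integral>\<^sup>+x. ennreal c * (indicator sink x * indicator B x) \<partial>lborel)"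
      by (intro nn_integral_cmult[symmetric]) measurable
    also have "\<dots> = (\<integral>\<^sup>+x. ennreal \<bar>neg_part profile x\<bar> * indicator B x \<partial>lborel)"
      unfolding abs_parts using c_pos by (intro nn_integral_cong) (auto simp: indicator_def)
    also have "\<dots> = emeasure ?\<nu> B"
      by (rule emeasure_density_measure[symmetric]) (use I_borel parts profile_outside B in auto)
    finally show "emeasure (distr ?\<mu> ?R shift) B = emeasure ?\<nu> B" .
  qed simp
  finally have \<gamma>: "\<gamma> \<in> couplings I ?\<mu> ?\<nu>" using 1 by (simp add: couplings_def \<gamma>_def)
  have cm: "(\<lambda>z::real\<times>real. \<bar>fst z - snd z\<bar>) \<in> borel_measurable borel"
    by (intro borel_measurable_continuous_onI continuous_intros)
  have "(LINT z|\<gamma>. \<bar>fst z - snd z\<bar> powr p) = (LINT x|?\<mu>. \<bar>x - shift x\<bar> powr p)"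
    unfolding \<gamma>_def using m cm by (subst integral_distr) (auto intro!: measurable_restrict_space1)
  also have "\<dots> = (LINT x|lborel. \<bar>pos_part profile x\<bar> * \<bar>x - shift x\<bar> powr p)"
    by (rule integral_density_measure) (use I_borel parts profile_outside in auto)
  also have "\<dots> = (LINT x|lborel. (d powr p * c) * indicator source x)"
    unfolding abs_parts by (intro Bochner_Integration.integral_cong refl) (auto simp: indicator_def shift_distance)
  also have "\<dots> = d powr p * (c * d * real (card S))"
    using measure_source_sink integrable_indicator_source_sink by simp
  finally show ?thesis
    unfolding transport_cost_def using wasserstein_le[OF \<gamma>, of p] by simp
qed

end

lemma antisymmetric_step_profile:
  assumes step: "antisymmetric_step I S c d f"
    and I: "I \<in> sets borel" and S: "finite S" and d: "0 < d" and c: "0 < c"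
    and disj: "\<And>z z'. z \<in> S \<Longrightarrow> z' \<in> S \<Longrightarrow> z \<noteq> z' \<Longrightarrow> 2 * d \<le> \<bar>z - z'\<bar>"
  obtains \<sigma> where "step_profile I S d c \<sigma>" "AE x in lebesgue_on I. f x = step_profile.profile S d c \<sigma> x"
proof -
  define down where "down z \<longleftrightarrow> (AE x in lebesgue_on I.
      (x \<in> {z - d<..<z} \<longrightarrow> f x = c) \<and> (x \<in> {z<..<z + d} \<longrightarrow> f x = - c))" for z
  define \<sigma> :: "real \<Rightarrow> real" where "\<sigma> z = (if down z then 1 else - 1)" for z
  interpret step_profile I S d c \<sigma>
  proof
    show "{z - d<..<z + d} \<subseteq> I" if "z \<in> S" for z
      using step that unfolding antisymmetric_step_def by blast
    show "\<sigma> z = 1 \<or> \<sigma> z = - 1" for z by (simp add: \<sigma>_def)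
  qed (fact I S d c disj)+
  have "AE x in lebesgue_on I. \<forall>z\<in>S. (x \<in> half_cell d (\<sigma> z) z \<longrightarrow> f x = c) \<and>
      (x \<in> half_cell d (- \<sigma> z) z \<longrightarrow> f x = - c)"
  proof (intro AE_finite_allI S)
    fix z assume z: "z \<in> S"
    then obtain s where s: "s \<in> {c, - c}" "AE x in lebesgue_on I.
           (x \<in> {z - d<..<z} \<longrightarrow> f x = s) \<and> (x \<in> {z<..<z + d} \<longrightarrow> f x = - s)"
      using step unfolding antisymmetric_step_def by blast
    show "AE x in lebesgue_on I. (x \<in> half_cell d (\<sigma> z) z \<longrightarrow> f x = c) \<and>
      (x \<in> half_cell d (- \<sigma> z) z \<longrightarrow> f x = - c)"
    proof (cases "\<sigma> z = 1")
      case True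
      then have "AE x in lebesgue_on I. (x \<in> {z - d<..<z} \<longrightarrow> f x = c) \<and> (x \<in> {z<..<z + d} \<longrightarrow> f x = - c)"
        unfolding down_def[symmetric] by (simp add: \<sigma>_def split: if_splits)
      then show ?thesis by (simp add: True half_cell_simps)
    next
      case False
      then have nd: "\<not> down z" by (auto simp: \<sigma>_def)
      have "s \<noteq> c"
      proof
        assume "s = c"
        with s(2) have "down z" unfolding down_def by simp
        then show False using nd by contradiction
      qed
      then have "s = - c" "\<sigma> z = - 1" using s(1) nd by (simp_all add: \<sigma>_def)
      then show ?thesis using s(2) by (simp add: half_cell_simps conj_commute)
    qed
  qed
  moreover have "AE x in lebesgue_on I. x \<notin> (\<Union>z\<in>S. {z - d<..<z + d}) \<longrightarrow> f x = 0"
    using step by (simp add: antisymmetric_step_def)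
  moreover have "AE x in lebesgue_on I. \<forall>z\<in>S. x \<noteq> z"
    unfolding AE_lebesgue_on_iff_lborel[OF I]
  proof -
    have "AE x in lborel. \<forall>z\<in>S. x \<noteq> z" using S by (intro AE_finite_allI AE_lborel_singleton)
    then show "AE x in lborel. x \<in> I \<longrightarrow> (\<forall>z\<in>S. x \<noteq> z)" by eventually_elim auto
  qed
  ultimately have "AE x in lebesgue_on I. f x = profile x"
  proof eventually_elim
    case (elim x)
    show ?case
    proof (cases "x \<in> source \<or> x \<in> sink")
      case True
      then show ?thesis using elim(1) source_sink_disjoint by (auto simp: profile_def source_def sink_def indicator_def)
    next
      case False
      have "x \<notin> (\<Union>z\<in>S. {z - d<..<z + d})"
      proof
        assume "x \<in> (\<Union>z\<in>S. {z - d<..<z + d})"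
        then obtain z where z: "z \<in> S" "x \<in> {z - d<..<z + d}" by blast
        then have "x \<noteq> z" using elim(3) by blast
        then have "x \<in> half_cell d (\<sigma> z) z \<union> half_cell d (- \<sigma> z) z"
          using half_cell_cases(2)[OF \<sigma>[of z], of z d] z(2) by blast
        then show False using False z(1) by (auto simp: source_def sink_def)
      qed
      then show ?thesis using False elim(2) by (simp add: profile_def)
    qed
  qed
  then show thesis using that step_profile_axioms by blast
qed

text \<open>The definition of \<open>antisymmetric_step\<close> does not ask for disjoint cells; that follows from the mass.
  With overlapping cells the union would be too short to carry the \<open>L\<^sup>1\<close> norm of \<open>f\<close> at height \<open>c\<close>.\<close>

lemma antisymmetric_step_disjoint:
  assumes step: "antisymmetric_step I S c d f" and I: "I \<in> sets borel"
    and S: "finite S" and d: "0 < d" and c: "0 < c"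
    and mass: "(\<integral>\<^sup>+x. ennreal \<bar>f x\<bar> \<partial>lebesgue_on I) = ennreal (2 * c * d * real (card S))"
    and z: "z \<in> S" "z' \<in> S" "z \<noteq> z'"
  shows "2 * d \<le> \<bar>z - z'\<bar>"
proof (rule ccontr)
  assume "\<not> 2 * d \<le> \<bar>z - z'\<bar>"
  then have lt: "max (z - d) (z' - d) < min (z + d) (z' + d)" using d by (auto simp: abs_if split: if_splits)
  define U where "U = (\<Union>z\<in>S. {z - d<..<z + d})"
  have U [measurable]: "U \<in> sets borel" unfolding U_def by (intro borel_open open_UN) auto
  have UI: "U \<subseteq> I" using step by (auto simp: U_def antisymmetric_step_def)
  have "AE x in lebesgue_on I. \<forall>z\<in>S. (x \<in> {z - d<..<z + d} - {z} \<longrightarrow> \<bar>f x\<bar> = c)"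
  proof (intro AE_finite_allI S)
    fix z assume "z \<in> S"
    then obtain s where s: "s \<in> {c, - c}" "AE x in lebesgue_on I.
           (x \<in> {z - d<..<z} \<longrightarrow> f x = s) \<and> (x \<in> {z<..<z + d} \<longrightarrow> f x = - s)"
      using step unfolding antisymmetric_step_def by blast
    from s(2) show "AE x in lebesgue_on I. (x \<in> {z - d<..<z + d} - {z} \<longrightarrow> \<bar>f x\<bar> = c)"
      by eventually_elim (use s(1) c in \<open>auto simp: less_le\<close>)
  qed
  moreover have "AE x in lebesgue_on I. x \<notin> U \<longrightarrow> f x = 0"
    using step by (simp add: antisymmetric_step_def U_def)
  moreover have "AE x in lebesgue_on I. \<forall>z\<in>S. x \<noteq> z"
    unfolding AE_lebesgue_on_iff_lborel[OF I]
  proof -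
    have "AE x in lborel. \<forall>z\<in>S. x \<noteq> z" using S by (intro AE_finite_allI AE_lborel_singleton)
    then show "AE x in lborel. x \<in> I \<longrightarrow> (\<forall>z\<in>S. x \<noteq> z)" by eventually_elim auto
  qed
  ultimately have "AE x in lebesgue_on I. ennreal \<bar>f x\<bar> = ennreal c * indicator U x"
    by eventually_elim (auto simp: U_def indicator_def)
  then have "(\<integral>\<^sup>+x. ennreal \<bar>f x\<bar> \<partial>lebesgue_on I) = (\<integral>\<^sup>+x. ennreal c * indicator U x \<partial>lebesgue_on I)"
    by (rule nn_integral_cong_AE)
  also have "\<dots> = (\<integral>\<^sup>+x. ennreal c * indicator U x \<partial>lborel)"
    by (rule nn_integral_lebesgue_on_eq_lborel) (use I UI in \<open>auto simp: indicator_def\<close>)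
  also have "\<dots> = ennreal c * emeasure lborel U" by (simp add: nn_integral_cmult)
  finally have "ennreal c * emeasure lborel U = ennreal c * ennreal (2 * d * real (card S))"
    using mass c d by (simp add: ennreal_mult'[symmetric] mult_ac)
  then have eU: "emeasure lborel U = ennreal (2 * d * real (card S))"
    using c by (subst (asm) ennreal_mult_cancel_left) auto
  define v where "v x = (\<Sum>z\<in>S. indicator {z - d<..<z + d} x :: real)" for x
  have vb: "has_bochner_integral lborel v (\<Sum>z\<in>S. 2 * d)"
    unfolding v_def[abs_def] using d
    by (intro has_bochner_integral_sum) (auto simp: has_bochner_integral_iff integrable_indicator_iff)
  have Ub: "has_bochner_integral lborel (indicator U :: real \<Rightarrow> real) (2 * d * real (card S))"
    using eU d by (auto simp: has_bochner_integral_iff integrable_indicator_iff measure_def)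
  \<comment> \<open>points of two overlapping cells are counted twice by \<open>v\<close>\<close>
  have two: "indicator U x + (if z - d < x \<and> x < z + d \<and> z' - d < x \<and> x < z' + d then 1 else 0) \<le> v x" for x
  proof (cases "z - d < x \<and> x < z + d \<and> z' - d < x \<and> x < z' + d")
    case True
    have "(\<Sum>z\<in>{z, z'}. indicator {z - d<..<z + d} x :: real) \<le> v x"
      unfolding v_def by (rule sum_mono2) (use S z in auto)
    then show ?thesis using True z(3) by (auto simp: indicator_def split: if_splits)
  next
    case False
    show ?thesis
    proof (cases "x \<in> U")
      case True
      then obtain w where w: "w \<in> S" "x \<in> {w - d<..<w + d}" by (auto simp: U_def)
      have "indicator {w - d<..<w + d} x \<le> v x"
        unfolding v_def by (rule member_le_sum) (use S w in auto)
      then show ?thesis using False w(2) by (auto simp: indicator_def split: if_splits)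
    next
      case False2: False
      have "0 \<le> v x" unfolding v_def by (intro sum_nonneg) auto
      then show ?thesis using False False2 by auto
    qed
  qed
  have "indicator U x \<le> v x" for x using two[of x] by (auto split: if_splits)
  moreover have "has_bochner_integral lborel (\<lambda>x. v x - indicator U x) ((\<Sum>z\<in>S. 2 * d) - 2 * d * real (card S))"
    using vb Ub by (rule has_bochner_integral_diff)
  ultimately have "AE x in lborel. v x - indicator U x = 0"
    by (subst integral_nonneg_eq_0_iff_AE[symmetric]) (simp_all add: has_bochner_integral_iff)
  from AE_lborel_ex_greaterThanLessThan[OF this lt] obtain x
    where "max (z - d) (z' - d) < x" "x < min (z + d) (z' + d)" "v x - indicator U x = 0" .
  then show False using two[of x] by auto
qed

section \<open>The alternating step function\<close>

text \<open>On the cell with index \<open>k\<close> the step function has the sign \<open>(- 1) ^ k\<close>.  The cells are centred at the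
  even multiples of \<open>d\<close>, hence the first and the last are cut in half by \<open>0\<close> and \<open>2 * N * d\<close>, and their
  \<open>N\<close> common endpoints are the odd multiples of \<open>d\<close>, where the sign changes.\<close>

definition alternating_cell :: "nat \<Rightarrow> real \<Rightarrow> nat \<Rightarrow> real set" where
  "alternating_cell N d k = {x. 0 < x \<and> x < 2 * real N * d \<and> (2 * real k - 1) * d \<le> x \<and> x < (2 * real k + 1) * d}"

definition alternating_step :: "nat \<Rightarrow> real \<Rightarrow> real \<Rightarrow> real \<Rightarrow> real" where
  "alternating_step N c d x = (\<Sum>k\<le>N. c * (- 1) ^ k * indicator (alternating_cell N d k) x)"

definition alternating_nodes :: "nat \<Rightarrow> real \<Rightarrow> real set" where
  "alternating_nodes N d = (\<lambda>k. (2 * real k + 1) * d) ` {..<N}"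

lemma alternating_cell_unique:
  assumes "0 < d" "x \<in> alternating_cell N d k" "x \<in> alternating_cell N d j"
  shows "k = j"
proof -
  have le: "k \<le> j" if "x \<in> alternating_cell N d k" "x \<in> alternating_cell N d j" for k j
  proof -
    have "(2 * real k - 1) * d < (2 * real j + 1) * d" using that by (auto simp: alternating_cell_def)
    then have "2 * real k - 1 < 2 * real j + 1" using assms(1) by simp
    then show ?thesis by linarith
  qed
  show ?thesis using le[OF assms(2,3)] le[OF assms(3,2)] by simp
qed

lemma alternating_step_cell:
  assumes "0 < d" "x \<in> alternating_cell N d k" "k \<le> N"
  shows "alternating_step N c d x = c * (- 1) ^ k"
proof -
  have "c * (- 1) ^ j * indicator (alternating_cell N d j) x = 0" if "j \<in> {..N} - {k}" for j
    using alternating_cell_unique[OF assms(1,2), of j] that by (auto simp: indicator_def)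
  then have "(\<Sum>j\<in>{..N} - {k}. c * (- 1) ^ j * indicator (alternating_cell N d j) x) = 0"
    by (rule sum.neutral[OF ballI])
  then have "(\<Sum>j\<le>N. c * (- 1) ^ j * indicator (alternating_cell N d j) x)
      = c * (- 1) ^ k * indicator (alternating_cell N d k) x"
    using assms(3) by (subst sum.remove[of _ k]) simp_all
  then show ?thesis using assms(2) by (simp add: alternating_step_def)
qed

lemma alternating_step_outside:
  assumes "\<not> (0 < x \<and> x < 2 * real N * d)"
  shows "alternating_step N c d x = 0"
proof -
  have "x \<notin> alternating_cell N d k" for k using assms by (auto simp: alternating_cell_def)
  then show ?thesis by (simp add: alternating_step_def)
qed

lemma alternating_step_borel: "alternating_step N c d \<in> borel_measurable borel"
proof -
  have [measurable]: "alternating_cell N d k \<in> sets borel" for k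
    unfolding alternating_cell_def by measurable
  show ?thesis unfolding alternating_step_def[abs_def] by measurable
qed

lemma card_alternating_nodes:
  assumes "0 < d"
  shows "finite (alternating_nodes N d)" "card (alternating_nodes N d) = N"
proof -
  have "inj_on (\<lambda>k. (2 * real k + 1) * d) {..<N}" using assms by (auto intro: inj_onI)
  then show "finite (alternating_nodes N d)" "card (alternating_nodes N d) = N"
    by (simp_all add: alternating_nodes_def card_image)
qed

lemma alternating_nodes_disjoint:
  assumes "0 < d" "z \<in> alternating_nodes N d" "z' \<in> alternating_nodes N d" "z \<noteq> z'"
  shows "2 * d \<le> \<bar>z - z'\<bar>"
proof -
  obtain k j :: nat where kj: "z = (2 * real k + 1) * d" "z' = (2 * real j + 1) * d" "k \<noteq> j"
    using assms by (auto simp: alternating_nodes_def)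
  have "1 \<le> \<bar>real k - real j\<bar>" using kj(3) by linarith
  then have "2 * d \<le> \<bar>real k - real j\<bar> * (2 * d)" using assms(1) by simp
  also have "\<dots> = \<bar>(real k - real j) * (2 * d)\<bar>" using assms(1) by (simp add: abs_mult)
  also have "(real k - real j) * (2 * d) = z - z'" using kj by (simp add: algebra_simps)
  finally show ?thesis .
qed

lemma alternating_step_near_node:
  assumes d: "0 < d" and k: "k < N" and z: "z = (2 * real k + 1) * d"
  shows "z - d < x \<Longrightarrow> x < z \<Longrightarrow> alternating_step N c d x = c * (- 1) ^ k"
    and "z \<le> x \<Longrightarrow> x < z + d \<Longrightarrow> alternating_step N c d x = - (c * (- 1) ^ k)"
    and "0 \<le> z - d" "z + d \<le> 2 * real N * d"
proof -
  have "real (Suc k) \<le> real N" using k by linarith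
  then have "(real k + 1) * d \<le> real N * d" using d by (intro mult_right_mono) auto
  then show b: "0 \<le> z - d" "z + d \<le> 2 * real N * d"
    using z d by (auto simp: algebra_simps)
  have ends: "(2 * real k - 1) * d = z - 2 * d" "(2 * real k + 1) * d = z"
    "(2 * real (Suc k) - 1) * d = z" "(2 * real (Suc k) + 1) * d = z + 2 * d"
    by (simp_all add: z algebra_simps)
  show "alternating_step N c d x = c * (- 1) ^ k" if "z - d < x" "x < z"
  proof (rule alternating_step_cell[OF d])
    show "x \<in> alternating_cell N d k"
      using that b d unfolding alternating_cell_def mem_Collect_eq ends by linarith
  qed (use k in simp)
  have "alternating_step N c d x = c * (- 1) ^ (Suc k)" if "z \<le> x" "x < z + d"
  proof (rule alternating_step_cell[OF d])
    show "x \<in> alternating_cell N d (Suc k)"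
      using that b d unfolding alternating_cell_def mem_Collect_eq ends by linarith
  qed (use k in simp)
  then show "alternating_step N c d x = - (c * (- 1) ^ k)" if "z \<le> x" "x < z + d" using that by simp
qed

lemma antisymmetric_alternating_step:
  assumes d: "0 < d" and L: "2 * real N * d \<le> L"
  shows "antisymmetric_step {0<..<L} (alternating_nodes N d) c d (alternating_step N c d)"
  unfolding antisymmetric_step_def
proof (intro conjI ballI)
  fix z assume "z \<in> alternating_nodes N d"
  then obtain k where k: "k < N" "z = (2 * real k + 1) * d" by (auto simp: alternating_nodes_def)
  note near = alternating_step_near_node[OF d k]
  show "{z - d<..<z + d} \<subseteq> {0<..<L}" using near(3,4) L by auto
  have "c * (- 1) ^ k \<in> {c, - c}" by (cases "even k") auto
  moreover have "AE x in lebesgue_on {0<..<L}. (x \<in> {z - d<..<z} \<longrightarrow> alternating_step N c d x = c * (- 1) ^ k) \<and>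
      (x \<in> {z<..<z + d} \<longrightarrow> alternating_step N c d x = - (c * (- 1) ^ k))"
    using near by (intro AE_I2) auto
  ultimately show "\<exists>s\<in>{c, - c}. AE x in lebesgue_on {0<..<L}. (x \<in> {z - d<..<z} \<longrightarrow> alternating_step N c d x = s) \<and>
      (x \<in> {z<..<z + d} \<longrightarrow> alternating_step N c d x = - s)" by blast
next
  have "AE x in lborel. \<forall>k\<in>{..N}. x \<noteq> 2 * real k * d"
    by (intro AE_finite_allI AE_lborel_singleton) auto
  then have "AE x in lborel. x \<in> {0<..<L} \<longrightarrow>
      (x \<notin> (\<Union>z\<in>alternating_nodes N d. {z - d<..<z + d}) \<longrightarrow> alternating_step N c d x = 0)"
  proof eventually_elim
    case (elim x)
    show ?case
    proof (intro impI)
      assume x: "x \<in> {0<..<L}" and out: "x \<notin> (\<Union>z\<in>alternating_nodes N d. {z - d<..<z + d})"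
      show "alternating_step N c d x = 0"
      proof (rule ccontr)
        assume "alternating_step N c d x \<noteq> 0"
        then have lt: "x < 2 * real N * d" using alternating_step_outside by blast
        define k where "k = nat \<lfloor>x / (2 * d)\<rfloor>"
        have "0 \<le> x / (2 * d)" using x d by simp
        then have "real k \<le> x / (2 * d)" "x / (2 * d) < real k + 1"
          unfolding k_def by linarith+
        then have k: "2 * real k * d \<le> x" "x < 2 * real k * d + 2 * d"
          using d by (auto simp: field_simps)
        then have "2 * real k * d < 2 * real N * d" using lt by linarith
        then have "k < N" using d by simp
        moreover from this have "x \<noteq> 2 * real k * d" using elim by auto
        ultimately have "(2 * real k + 1) * d \<in> alternating_nodes N d"
          "x \<in> {(2 * real k + 1) * d - d<..<(2 * real k + 1) * d + d}"
          using k by (auto simp: alternating_nodes_def algebra_simps)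
        then show False using out by blast
      qed
    qed
  qed
  then show "AE x in lebesgue_on {0<..<L}.
      x \<notin> (\<Union>z\<in>alternating_nodes N d. {z - d<..<z + d}) \<longrightarrow> alternating_step N c d x = 0"
    by (subst AE_lebesgue_on_iff_lborel) auto
qed

text \<open>Away from the nodes only one sign occurs locally.  The last clause provides a single neighbourhood of
  the whole zero region, which rules out that the zero component there touches both signs.\<close>

lemma alternating_step_one_signed:
  assumes d: "0 < d" and x: "0 < x" "x \<notin> alternating_nodes N d"
  obtains U s where "open U" "x \<in> U" "\<And>y. y \<in> U \<Longrightarrow> alternating_step N c d y \<in> {0, s}"
    "2 * real N * d \<le> x \<Longrightarrow> {2 * real N * d..} \<subseteq> U"
proof (cases "(2 * real N - 1) * d < x")
  case True
  have "alternating_step N c d y \<in> {0, c * (- 1) ^ N}" if "(2 * real N - 1) * d < y" for y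
  proof (cases "0 < y \<and> y < 2 * real N * d")
    case True
    then have "y \<in> alternating_cell N d N" using that d by (auto simp: alternating_cell_def algebra_simps)
    then show ?thesis using alternating_step_cell[OF d] by auto
  next
    case False
    then show ?thesis using alternating_step_outside by auto
  qed
  moreover have "{2 * real N * d..} \<subseteq> {(2 * real N - 1) * d<..}" using d by (auto simp: algebra_simps)
  ultimately show thesis using that[of "{(2 * real N - 1) * d<..}" "c * (- 1) ^ N"] True by auto
next
  case False
  define k where "k = nat \<lfloor>(x / d + 1) / 2\<rfloor>"
  have "0 \<le> (x / d + 1) / 2" using x d by simp
  then have "real k \<le> (x / d + 1) / 2" "(x / d + 1) / 2 < real k + 1"
    unfolding k_def by linarith+
  then have k: "(2 * real k - 1) * d \<le> x" "x < (2 * real k + 1) * d"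
    using d by (auto simp: field_simps)
  then have "(2 * real k - 1) * d \<le> (2 * real N - 1) * d" using False by linarith
  then have kN: "k \<le> N" using d by simp
  have "x \<noteq> (2 * real k - 1) * d"
  proof
    assume eq: "x = (2 * real k - 1) * d"
    have "k \<noteq> 0"
    proof
      assume "k = 0"
      then have "x = - d" using eq by simp
      then show False using x d by simp
    qed
    then have "x = (2 * real (k - 1) + 1) * d" "k - 1 < N" using eq kN by (auto simp: of_nat_diff)
    then show False using x(2) by (auto simp: alternating_nodes_def)
  qed
  with k have xk: "(2 * real k - 1) * d < x" by simp
  have kN': "k \<noteq> N" using xk False by auto
  have "alternating_step N c d y \<in> {0, c * (- 1) ^ k}" if "y \<in> {(2 * real k - 1) * d<..<(2 * real k + 1) * d}" for y
  proof (cases "0 < y \<and> y < 2 * real N * d")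
    case True
    then have "y \<in> alternating_cell N d k" using that d by (auto simp: alternating_cell_def)
    then show ?thesis using alternating_step_cell[OF d _ kN] by auto
  next
    case False
    then show ?thesis using alternating_step_outside by auto
  qed
  moreover have "x < 2 * real N * d" using False d by (simp add: algebra_simps)
  ultimately show thesis
    using that[of "{(2 * real k - 1) * d<..<(2 * real k + 1) * d}" "c * (- 1) ^ k"] xk k by auto
qed

lemma one_signed_boundaries:
  assumes "open U" "\<And>y. y \<in> U \<Longrightarrow> f y \<in> {0, s}"
  shows "U \<inter> pos_boundary I f = {} \<or> U \<inter> neg_boundary I f = {}"
proof -
  have *: "U \<inter> (top_of_set I frontier_of A) = {}" if A: "A \<subseteq> I" "U \<inter> A = {}" for A
  proof -
    have "U \<inter> closure A = {}" using A(2) assms(1) by (simp add: open_Int_closure_eq_empty)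
    moreover have "top_of_set I frontier_of A \<subseteq> closure A"
      using A(1) by (auto simp: frontier_of_def closure_of_subtopology Int_absorb1)
    ultimately show ?thesis by blast
  qed
  show ?thesis
  proof (cases "0 < s")
    case True
    have "0 \<le> f y" if "y \<in> U" for y using assms(2)[OF that] True by auto
    then have "U \<inter> {x\<in>I. f x < 0} = {}" by fastforce
    then show ?thesis unfolding neg_boundary_def by (intro disjI2 *) auto
  next
    case False
    have "f y \<le> 0" if "y \<in> U" for y using assms(2)[OF that] False by auto
    then have "U \<inter> {x\<in>I. f x > 0} = {}" by fastforce
    then show ?thesis unfolding pos_boundary_def by (intro disjI1 *) auto
  qed
qed

text \<open>Each node is adherent to both signs.  There is no other sign change, and the zeros, if there
  are any, fill the interval to the right of the last cell, which is adjacent to one sign only.\<close>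

lemma nodal_set_alternating_step:
  assumes d: "0 < d" and c: "0 < c" and L: "2 * real N * d \<le> L" and N: "0 < N"
    and tr: "transversal (sign_change_components {0<..<L} (alternating_step N c d)) (Z2 (alternating_step N c d))"
  shows "nodal_set Z2 {0<..<L} (alternating_step N c d) = alternating_nodes N d"
proof -
  let ?f = "alternating_step N c d" and ?I = "{0<..<L}"
  have bsub: "pos_boundary ?I ?f \<subseteq> ?I" "neg_boundary ?I ?f \<subseteq> ?I"
    unfolding pos_boundary_def neg_boundary_def
    using frontier_of_subset_topspace[of "top_of_set ?I"] by auto
  have "Z1 ?I ?f \<subseteq> alternating_nodes N d"
  proof (rule subsetI, rule ccontr)
    fix x assume x: "x \<in> Z1 ?I ?f" "x \<notin> alternating_nodes N d"
    then have x0: "0 < x" using bsub by (auto simp: Z1_def)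
    obtain U s where U: "open U" "x \<in> U" "\<And>y. y \<in> U \<Longrightarrow> ?f y \<in> {0, s}"
      using alternating_step_one_signed[OF d x0 x(2)] by metis
    have "U \<inter> pos_boundary ?I ?f = {} \<or> U \<inter> neg_boundary ?I ?f = {}"
      by (rule one_signed_boundaries[OF U(1), where s=s]) (rule U(3))
    then show False using x(1) U(2) by (auto simp: Z1_def)
  qed
  moreover have "alternating_nodes N d \<subseteq> Z1 ?I ?f"
  proof
    fix z assume "z \<in> alternating_nodes N d"
    then obtain k where k: "k < N" "z = (2 * real k + 1) * d" by (auto simp: alternating_nodes_def)
    note near = alternating_step_near_node[OF d k]
    define s where "s = c * (- 1) ^ k"
    have s: "s = c \<or> s = - c" unfolding s_def by (cases "even k") auto
    have cl: "z \<in> closure A" if "{z - d<..<z} \<subseteq> A \<or> {z<..<z + d} \<subseteq> A" for A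
      using that
    proof
      assume "{z - d<..<z} \<subseteq> A"
      from closure_mono[OF this] show ?thesis using d by (auto simp: closure_greaterThanLessThan)
    next
      assume "{z<..<z + d} \<subseteq> A"
      from closure_mono[OF this] show ?thesis using d by (auto simp: closure_greaterThanLessThan)
    qed
    have sub: "{z - d<..<z} \<subseteq> ?I" "{z<..<z + d} \<subseteq> ?I" "z \<in> ?I" using near(3,4) L d by auto
    have "{z - d<..<z} \<subseteq> {x\<in>?I. ?f x > 0} \<or> {z<..<z + d} \<subseteq> {x\<in>?I. ?f x > 0}"
      using near(1,2)[where c=c, folded s_def] s c sub by auto
    then have 1: "z \<in> closure {x\<in>?I. ?f x > 0}" by (rule cl)
    have "{z - d<..<z} \<subseteq> {x\<in>?I. ?f x < 0} \<or> {z<..<z + d} \<subseteq> {x\<in>?I. ?f x < 0}"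
      using near(1,2)[where c=c, folded s_def] s c sub by auto
    then have 2: "z \<in> closure {x\<in>?I. ?f x < 0}" by (rule cl)
    show "z \<in> Z1 ?I ?f"
      unfolding Z1_def pos_boundary_def neg_boundary_def
    proof (rule IntI)
      show "z \<in> top_of_set ?I frontier_of {x\<in>?I. ?f x > 0}"
        by (rule frontier_of_adherent[where B="{x\<in>?I. ?f x < 0}"]) (use 1 2 sub in auto)
      show "z \<in> top_of_set ?I frontier_of {x\<in>?I. ?f x < 0}"
        by (rule frontier_of_adherent[where B="{x\<in>?I. ?f x > 0}"]) (use 1 2 sub in auto)
    qed
  qed
  moreover have "Z2 ?f = {}"
  proof -
    have "sign_change_components ?I ?f = {}"
    proof (rule ccontr)
      assume "sign_change_components ?I ?f \<noteq> {}"
      then obtain J where J: "J \<in> components {x\<in>?I. ?f x = 0}"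
        "(top_of_set ?I closure_of J) \<inter> pos_boundary ?I ?f \<noteq> {}"
        "(top_of_set ?I closure_of J) \<inter> neg_boundary ?I ?f \<noteq> {}"
        by (auto simp: sign_change_components_def)
      have zero: "2 * real N * d \<le> x" if "x \<in> ?I" "?f x = 0" for x
      proof (rule ccontr)
        assume lt: "\<not> 2 * real N * d \<le> x"
        define k where "k = nat \<lfloor>(x / d + 1) / 2\<rfloor>"
        have "0 \<le> (x / d + 1) / 2" using that d by simp
        then have "real k \<le> (x / d + 1) / 2" "(x / d + 1) / 2 < real k + 1"
          unfolding k_def by linarith+
        then have k: "(2 * real k - 1) * d \<le> x" "x < (2 * real k + 1) * d"
          using d by (auto simp: field_simps)
        then have "(2 * real k - 1) * d < 2 * real N * d" using lt by linarith
        then have "2 * real k - 1 < 2 * real N" using d by simp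
        then have "k \<le> N" by linarith
        moreover have "x \<in> alternating_cell N d k" using that lt k by (auto simp: alternating_cell_def)
        ultimately have "?f x = c * (- 1) ^ k" using alternating_step_cell[OF d] by blast
        then show False using that c by simp
      qed
      define b where "b = 2 * real N * d"
      have b0: "0 < b" using N d by (simp add: b_def)
      have "b \<notin> alternating_nodes N d"
      proof
        assume "b \<in> alternating_nodes N d"
        then obtain k :: nat where "k < N" "2 * real N * d = (2 * real k + 1) * d"
          by (auto simp: alternating_nodes_def b_def)
        then show False using d alternating_step_near_node(4)[OF d, of k N "(2 * real k + 1) * d"] by simp
      qed
      from alternating_step_one_signed[OF d b0 this]
      obtain U s where U: "open U" "\<And>y. y \<in> U \<Longrightarrow> ?f y \<in> {0, s}" "{b..} \<subseteq> U"
        unfolding b_def by (metis order_refl)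
      have "J \<subseteq> {x\<in>?I. ?f x = 0}" using J(1) by (rule in_components_subset)
      then have JI: "J \<subseteq> ?I" and "J \<subseteq> {b..}" using zero by (auto simp: b_def)
      then have "closure J \<subseteq> {b..}" by (intro closure_minimal) auto
      then have "top_of_set ?I closure_of J \<subseteq> U"
        using U(3) JI by (auto simp: closure_of_subtopology Int_absorb1)
      moreover have "U \<inter> pos_boundary ?I ?f = {} \<or> U \<inter> neg_boundary ?I ?f = {}"
        by (rule one_signed_boundaries[OF U(1), where s=s]) (rule U(2))
      ultimately show False using J(2,3) by blast
    qed
    then show ?thesis using tr by (auto simp: transversal_def)
  qed
  ultimately show ?thesis by (simp add: nodal_set_def)
qed

section \<open>Minimizers of the transport cost\<close>

lemma transport_cost_cong_AE:
  assumes "f \<in> borel_measurable (lebesgue_on I)" "g \<in> borel_measurable (lebesgue_on I)"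
    and "AE x in lebesgue_on I. f x = g x"
  shows "transport_cost p I f = transport_cost p I g"
proof -
  have "AE x in lebesgue_on I. pos_part f x = pos_part g x" "AE x in lebesgue_on I. neg_part f x = neg_part g x"
    using assms(3) by (eventually_elim; simp add: pos_part_def neg_part_def)+
  then have "density_measure I (pos_part f) = density_measure I (pos_part g)"
    "density_measure I (neg_part f) = density_measure I (neg_part g)"
    using assms(1,2) by (auto intro!: density_measure_cong_AE measurable_pos_neg_part)
  then show ?thesis by (simp add: transport_cost_def)
qed

lemma AE_abs_le_esssup:
  assumes "esssup (lebesgue_on I) (\<lambda>x. ennreal \<bar>f x\<bar>) = ennreal c" "0 \<le> c"
  shows "AE x in lebesgue_on I. \<bar>f x\<bar> \<le> c"
proof -
  have "AE x in lebesgue_on I. ennreal \<bar>f x\<bar> \<le> ennreal c"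
    using esssup_AE[of "\<lambda>x. ennreal \<bar>f x\<bar>" "lebesgue_on I"] assms(1) by simp
  then show ?thesis by eventually_elim (use assms(2) in simp)
qed

text \<open>Besides being Borel, the representative is bounded pointwise and vanishes on the finite nodal set,
  as the analysis of the equality case needs.\<close>

lemma admissible_representative:
  assumes f: "f \<in> admissible Z2 c c1 N I" and I: "I \<in> sets borel" "bounded I" "is_interval I"
    and c: "0 < c" "0 < c1"
    and tr: "transversal (sign_change_components I f) (Z2 f)"
  obtains g where "balanced_density I g c c1" "separates (nodal_set Z2 I f) g"
    "\<And>z. z \<in> nodal_set Z2 I f \<Longrightarrow> g z = 0"
    "AE x in lebesgue_on I. g x = f x" "transport_cost p I f = transport_cost p I g"
proof -
  let ?S = "nodal_set Z2 I f"
  have fm: "f \<in> borel_measurable (lebesgue_on I)" and S: "finite ?S"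
    and norm: "(\<integral>\<^sup>+x. ennreal \<bar>f x\<bar> \<partial>lebesgue_on I) = ennreal c1"
    and mean: "(LINT x|lebesgue_on I. f x) = 0"
    and ess: "esssup (lebesgue_on I) (\<lambda>x. ennreal \<bar>f x\<bar>) = ennreal c"
    using f by (auto simp: admissible_def)
  obtain g' where g': "g' \<in> borel_measurable borel" "\<And>x. g' x = 0 \<or> x \<in> I \<and> g' x = f x"
    "AE x in lebesgue_on I. g' x = f x" using borel_representative[OF I(1) fm] by blast
  define g where "g x = (if c < \<bar>g' x\<bar> \<or> x \<in> ?S then 0 else g' x)" for x
  note [measurable] = g'(1)
  have [measurable]: "?S \<in> sets borel" using S by (intro borel_closed finite_imp_closed)
  have gm: "g \<in> borel_measurable borel" unfolding g_def[abs_def] by measurable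
  have g0: "g x = 0 \<or> x \<in> I \<and> g x = f x" for x using g'(2)[of x] by (auto simp: g_def)
  then have gout: "g x = 0" if "x \<notin> I" for x using that by blast
  have "AE x in lborel. \<forall>z\<in>?S. x \<noteq> z" using S by (intro AE_finite_allI AE_lborel_singleton)
  then have "AE x in lebesgue_on I. x \<notin> ?S"
    unfolding AE_lebesgue_on_iff_lborel[OF I(1)] by eventually_elim auto
  with g'(3) AE_abs_le_esssup[OF ess less_imp_le[OF c(1)]] have gf: "AE x in lebesgue_on I. g x = f x"
    by eventually_elim (use c in \<open>auto simp: g_def\<close>)
  have gL: "g \<in> borel_measurable (lebesgue_on I)" by (rule borel_imp_lebesgue_on[OF gm])
  have "(\<integral>\<^sup>+x. ennreal \<bar>g x\<bar> \<partial>lborel) = (\<integral>\<^sup>+x. ennreal \<bar>g x\<bar> \<partial>lebesgue_on I)"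
    by (rule nn_integral_lebesgue_on_eq_lborel[symmetric]) (use I gm gout in auto)
  also have "\<dots> = (\<integral>\<^sup>+x. ennreal \<bar>f x\<bar> \<partial>lebesgue_on I)"
    by (rule nn_integral_cong_AE) (use gf in eventually_elim, simp)
  finally have nn: "(\<integral>\<^sup>+x. ennreal \<bar>g x\<bar> \<partial>lborel) = ennreal c1" using norm by simp
  have int: "integrable lborel g" using gm nn by (simp add: integrable_iff_bounded)
  have "balanced_density I g c c1"
  proof
    show "I \<in> sets borel" "bounded I" "is_interval I" "0 < c" "0 < c1" "integrable lborel g" by fact+
    show "\<And>x. x \<notin> I \<Longrightarrow> g x = 0" by (rule gout)
    show "\<bar>g x\<bar> \<le> c" for x using c by (auto simp: g_def)
    have "(LINT x|lborel. g x) = (LINT x|lebesgue_on I. g x)"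
      by (rule integral_lebesgue_on_eq_lborel[symmetric]) (use I gm gout in auto)
    also have "\<dots> = (LINT x|lebesgue_on I. f x)" by (rule integral_cong_AE[OF gL fm gf])
    finally show "(LINT x|lborel. g x) = 0" using mean by simp
    have "ennreal (LINT x|lborel. \<bar>g x\<bar>) = ennreal c1"
      using nn_integral_eq_integral[of lborel "\<lambda>x. \<bar>g x\<bar>"] int nn by simp
    then show "(LINT x|lborel. \<bar>g x\<bar>) = c1" using c by simp
  qed
  moreover have "separates ?S g"
    by (rule nodal_set_separates[of I f Z2 g, OF I(3) tr g0])
  moreover have "\<And>z. z \<in> ?S \<Longrightarrow> g z = 0" by (simp add: g_def)
  moreover have "transport_cost p I f = transport_cost p I g"
    using transport_cost_cong_AE[OF gL fm gf] by simp
  ultimately show thesis using that gf by blast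
qed

lemma admissible_cost_ge:
  assumes f: "f \<in> admissible Z2 c c1 N I" and I: "I \<in> sets borel" "bounded I" "is_interval I"
    and c: "0 < c" "0 < c1" and p: "1 \<le> p"
    and tr: "transversal (sign_change_components I f) (Z2 f)"
    and d: "d = c1 / (2 * c * real N)"
  shows "(d powr p * (c1 / 2)) powr (1 / p) \<le> transport_cost p I f"
proof -
  obtain g where g: "balanced_density I g c c1" "separates (nodal_set Z2 I f) g"
    "transport_cost p I f = transport_cost p I g"
    using admissible_representative[OF f I c tr] by metis
  then interpret balanced_density I g c c1 by simp
  have S: "finite (nodal_set Z2 I f)" "card (nodal_set Z2 I f) = N" using f by (auto simp: admissible_def)
  show ?thesis
    using transport_cost_ge[OF S(1) separates_nonempty[OF g(2)] g(2) p] d S(2) g(3) by simp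
qed

lemma optimal_imp_antisymmetric_step:
  assumes f: "f \<in> admissible Z2 c c1 N I" and I: "I \<in> sets borel" "bounded I" "is_interval I"
    and c: "0 < c" "0 < c1" and p: "1 \<le> p"
    and tr: "transversal (sign_change_components I f) (Z2 f)"
    and d: "d = c1 / (2 * c * real N)"
    and cost: "transport_cost p I f \<le> (d powr p * (c1 / 2)) powr (1 / p)"
  shows "antisymmetric_step I (nodal_set Z2 I f) c d f"
proof -
  let ?S = "nodal_set Z2 I f"
  obtain g where g: "balanced_density I g c c1" "separates ?S g"
    "\<And>z. z \<in> ?S \<Longrightarrow> g z = 0" "AE x in lebesgue_on I. g x = f x"
    "transport_cost p I f = transport_cost p I g"
    using admissible_representative[OF f I c tr, of p] by metis
  then interpret balanced_density I g c c1 by simp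
  have S: "finite ?S" "card ?S = N" using f by (auto simp: admissible_def)
  have d': "d = c1 / (2 * c * real (card ?S))" using d S by simp
  have cost': "transport_cost p I g \<le> (d powr p * (c1 / 2)) powr (1 / p)" using cost g(5) by simp
  have transfer: "AE x in lebesgue_on I. R x (f x)" if "AE x in lborel. R x (g x)" for R
  proof -
    have "AE x in lebesgue_on I. R x (g x)"
      unfolding AE_lebesgue_on_iff_lborel[OF I(1)] using that by eventually_elim simp
    with g(4) show ?thesis by eventually_elim simp
  qed
  show ?thesis
    unfolding antisymmetric_step_def
  proof (intro conjI ballI)
    show "{z - d<..<z + d} \<subseteq> I" if "z \<in> ?S" for z
      by (rule minimizer_structure(1)[OF S(1) g(2) _ p d' cost' that]) (rule g(3))
    show "\<exists>s\<in>{c, - c}. AE x in lebesgue_on I.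
        (x \<in> {z - d<..<z} \<longrightarrow> f x = s) \<and> (x \<in> {z<..<z + d} \<longrightarrow> f x = - s)" if "z \<in> ?S" for z
    proof -
      note z = that
      obtain s where "s \<in> {c, - c}" "AE x in lborel.
          (x \<in> {z - d<..<z} \<longrightarrow> g x = s) \<and> (x \<in> {z<..<z + d} \<longrightarrow> g x = - s)"
        using minimizer_structure(2)[OF S(1) g(2) _ p d' cost' z] g(3) by blast
      then show ?thesis
        using transfer[of "\<lambda>x y. (x \<in> {z - d<..<z} \<longrightarrow> y = s) \<and> (x \<in> {z<..<z + d} \<longrightarrow> y = - s)"] by blast
    qed
    show "AE x in lebesgue_on I. x \<notin> (\<Union>z\<in>?S. {z - d<..<z + d}) \<longrightarrow> f x = 0"
      using transfer[of "\<lambda>x y. x \<notin> (\<Union>z\<in>?S. {z - d<..<z + d}) \<longrightarrow> y = 0"] minimizer_structure(3)[OF S(1) g(2) _ p d' cost'] g(3) by blast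
  qed
qed

lemma antisymmetric_step_cost_le:
  assumes f: "f \<in> admissible Z2 c c1 N I" and I: "I \<in> sets borel"
    and c: "0 < c" "0 < c1" and N: "1 \<le> N"
    and d: "d = c1 / (2 * c * real N)"
    and step: "antisymmetric_step I (nodal_set Z2 I f) c d f"
  shows "transport_cost p I f \<le> (d powr p * (c1 / 2)) powr (1 / p)"
proof -
  let ?S = "nodal_set Z2 I f"
  have S: "finite ?S" "card ?S = N" and fm: "f \<in> borel_measurable (lebesgue_on I)"
    and norm: "(\<integral>\<^sup>+x. ennreal \<bar>f x\<bar> \<partial>lebesgue_on I) = ennreal c1"
    using f by (auto simp: admissible_def)
  have d0: "0 < d" and mass: "c * d * real N = c1 / 2" using d c N by simp_all
  have "2 * c * d * real N = c1" using mass by simp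
  then have norm': "(\<integral>\<^sup>+x. ennreal \<bar>f x\<bar> \<partial>lebesgue_on I) = ennreal (2 * c * d * real (card ?S))"
    using norm S(2) by (simp only:)
  have disj: "2 * d \<le> \<bar>z - z'\<bar>" if "z \<in> ?S" "z' \<in> ?S" "z \<noteq> z'" for z z'
    using antisymmetric_step_disjoint[OF step I S(1) d0 c(1) norm' that] .
  obtain \<sigma> where prof: "step_profile I ?S d c \<sigma>"
    "AE x in lebesgue_on I. f x = step_profile.profile ?S d c \<sigma> x"
    using antisymmetric_step_profile[OF step I S(1) d0 c(1) disj] by blast
  then interpret step_profile I ?S d c \<sigma> by simp
  have "transport_cost p I f = transport_cost p I profile"
    by (rule transport_cost_cong_AE[OF fm borel_imp_lebesgue_on[OF profile_borel] prof(2)])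
  then show ?thesis using transport_cost_profile_le[of p] mass S(2) by simp
qed

lemma alternating_step_admissible:
  assumes d: "0 < d" and c: "0 < c" and N: "1 \<le> N" and L: "2 * real N * d \<le> L"
    and tr: "transversal (sign_change_components {0<..<L} (alternating_step N c d)) (Z2 (alternating_step N c d))"
  shows "alternating_step N c d \<in> admissible Z2 c (2 * c * d * real N) N {0<..<L}"
proof -
  let ?f = "alternating_step N c d" and ?I = "{0<..<L}" and ?S = "alternating_nodes N d"
  have nodes: "nodal_set Z2 ?I ?f = ?S"
    using nodal_set_alternating_step[of d c N L Z2] assms by simp
  note S = card_alternating_nodes[OF d, of N]
  have step: "antisymmetric_step ?I ?S c d ?f" by (rule antisymmetric_alternating_step[OF d L])
  have I: "?I \<in> sets borel" by simp
  have disj: "2 * d \<le> \<bar>z - z'\<bar>" if "z \<in> ?S" "z' \<in> ?S" "z \<noteq> z'" for z z'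
    by (rule alternating_nodes_disjoint[OF d that])
  obtain \<sigma> where prof: "step_profile ?I ?S d c \<sigma>"
    "AE x in lebesgue_on ?I. ?f x = step_profile.profile ?S d c \<sigma> x"
    using antisymmetric_step_profile[OF step I S(1) d c disj] by blast
  then interpret step_profile ?I ?S d c \<sigma> by simp
  have fm: "?f \<in> borel_measurable (lebesgue_on ?I)" by (rule borel_imp_lebesgue_on[OF alternating_step_borel])
  have pm: "profile \<in> borel_measurable (lebesgue_on ?I)" by (rule borel_imp_lebesgue_on[OF profile_borel])
  have "(LINT x|lebesgue_on ?I. ?f x) = (LINT x|lebesgue_on ?I. profile x)"
    by (rule integral_cong_AE[OF fm pm prof(2)])
  also have "\<dots> = (LINT x|lborel. profile x)"
    by (rule integral_lebesgue_on_eq_lborel) (use profile_borel profile_outside in auto)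
  finally have mean: "(LINT x|lebesgue_on ?I. ?f x) = 0" using integral_profile by simp
  have "(\<integral>\<^sup>+x. ennreal \<bar>?f x\<bar> \<partial>lebesgue_on ?I) = (\<integral>\<^sup>+x. ennreal \<bar>profile x\<bar> \<partial>lebesgue_on ?I)"
    by (rule nn_integral_cong_AE) (use prof(2) in eventually_elim, simp)
  also have "\<dots> = (\<integral>\<^sup>+x. ennreal \<bar>profile x\<bar> \<partial>lborel)"
    by (rule nn_integral_lebesgue_on_eq_lborel) (use profile_borel profile_outside in auto)
  finally have norm: "(\<integral>\<^sup>+x. ennreal \<bar>?f x\<bar> \<partial>lebesgue_on ?I) = ennreal (2 * c * d * real N)"
    using nn_integral_profile S(2) by simp
  have am: "(\<lambda>x. ennreal \<bar>?f x\<bar>) \<in> borel_measurable (lebesgue_on ?I)" using fm by simp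
  have "AE x in lebesgue_on ?I. ennreal \<bar>?f x\<bar> \<le> ennreal c"
    using prof(2) by eventually_elim (use abs_parts(3) c in \<open>auto simp: indicator_def intro!: ennreal_leI\<close>)
  then have le: "esssup (lebesgue_on ?I) (\<lambda>x. ennreal \<bar>?f x\<bar>) \<le> ennreal c" by (rule esssup_I[OF am])
  have ge: "ennreal c \<le> esssup (lebesgue_on ?I) (\<lambda>x. ennreal \<bar>?f x\<bar>)"
  proof -
    have "AE x in lborel. x \<in> ?I \<longrightarrow> ennreal \<bar>?f x\<bar> \<le> esssup (lebesgue_on ?I) (\<lambda>x. ennreal \<bar>?f x\<bar>)"
      using esssup_AE[of "\<lambda>x. ennreal \<bar>?f x\<bar>" "lebesgue_on ?I"] by (simp add: AE_lebesgue_on_iff_lborel)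
    \<comment> \<open>on \<open>(0, d)\<close> the function takes the value \<open>c\<close>\<close>
    from AE_lborel_ex_greaterThanLessThan[OF this d] obtain x where x: "0 < x" "x < d"
      "x \<in> ?I \<longrightarrow> ennreal \<bar>?f x\<bar> \<le> esssup (lebesgue_on ?I) (\<lambda>x. ennreal \<bar>?f x\<bar>)" .
    have near: "d \<le> 2 * real N * d" using N d by simp
    then have "x < 2 * real N * d" using x by linarith
    then have "x \<in> alternating_cell N d 0" using x d by (simp add: alternating_cell_def)
    then have "?f x = c" using alternating_step_cell[OF d, of x N 0 c] by simp
    then show ?thesis using x near L c by simp
  qed
  show ?thesis
    using fm mean norm S nodes antisym[OF le ge] by (simp add: admissible_def)
qed

theorem theorem5:
  fixes L p cinf c1 :: real and N :: nat and I :: "real set"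
    and Z2 :: "(real \<Rightarrow> real) \<Rightarrow> real set"
  assumes "L > 0" and "I = {0<..<L}" and "p \<ge> 1" and "cinf > 0"
    and "0 < c1" and "c1 \<le> L * cinf" and "N \<ge> 1"
    and "\<And>f. transversal (sign_change_components I f) (Z2 f)"
  shows "(\<exists>f. is_arg_min (transport_cost p I) (\<lambda>g. g \<in> admissible Z2 cinf c1 N I) f) \<and>
    (\<forall>f. is_arg_min (transport_cost p I) (\<lambda>g. g \<in> admissible Z2 cinf c1 N I) f \<longleftrightarrow>
       f \<in> admissible Z2 cinf c1 N I \<and>
       antisymmetric_step I (nodal_set Z2 I f) cinf (c1 / (2 * cinf * real N)) f) \<and>
    (\<forall>f. is_arg_min (transport_cost p I) (\<lambda>g. g \<in> admissible Z2 cinf c1 N I) f \<longrightarrow>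
       transport_cost p I f =
         2 powr (- ((p + 1) / p)) * (c1 / (real N * cinf)) * c1 powr (1 / p))"
proof -
  define d where "d = c1 / (2 * cinf * real N)"
  define B where "B = (d powr p * (c1 / 2)) powr (1 / p)"
  have I: "I \<in> sets borel" "bounded I" "is_interval I" using assms(2) by (auto simp: is_interval_1)
  have d0: "0 < d" using assms(4,5,7) by (simp add: d_def)
  have mass: "2 * cinf * d * real N = c1" using assms(4,7) by (simp add: d_def)
  have "2 * real N * d = c1 / cinf" using assms(4,7) by (simp add: d_def)
  then have fits: "2 * real N * d \<le> L" using assms(4,6) by (simp add: pos_divide_le_eq)
  have ge: "B \<le> transport_cost p I f" if "f \<in> admissible Z2 cinf c1 N I" for f
    unfolding B_def by (rule admissible_cost_ge[OF that I assms(4,5,3,8) d_def])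
  have opt: "antisymmetric_step I (nodal_set Z2 I f) cinf d f"
    if "f \<in> admissible Z2 cinf c1 N I" "transport_cost p I f \<le> B" for f
    by (rule optimal_imp_antisymmetric_step[OF that(1) I assms(4,5,3,8) d_def])
       (use that(2) in \<open>simp add: B_def\<close>)
  have le: "transport_cost p I f \<le> B"
    if "f \<in> admissible Z2 cinf c1 N I" "antisymmetric_step I (nodal_set Z2 I f) cinf d f" for f
    unfolding B_def by (rule antisymmetric_step_cost_le[OF that(1) I(1) assms(4,5,7) d_def that(2)])
  define f0 where "f0 = alternating_step N cinf d"
  have f0: "f0 \<in> admissible Z2 cinf c1 N I"
    using alternating_step_admissible[OF d0 assms(4,7) fits] assms(8) unfolding f0_def assms(2) mass by blast
  have "nodal_set Z2 I f0 = alternating_nodes N d"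
    unfolding f0_def assms(2)
    by (rule nodal_set_alternating_step[OF d0 assms(4) fits]) (use assms(7,8) in \<open>auto simp: assms(2)\<close>)
  then have "antisymmetric_step I (nodal_set Z2 I f0) cinf d f0"
    using antisymmetric_alternating_step[OF d0 fits] by (simp add: f0_def assms(2))
  then have f0_cost: "transport_cost p I f0 \<le> B" by (rule le[OF f0])
  have argmin: "is_arg_min (transport_cost p I) (\<lambda>g. g \<in> admissible Z2 cinf c1 N I) f \<longleftrightarrow>
      f \<in> admissible Z2 cinf c1 N I \<and> transport_cost p I f \<le> B" for f
  proof
    assume "is_arg_min (transport_cost p I) (\<lambda>g. g \<in> admissible Z2 cinf c1 N I) f"
    then have "f \<in> admissible Z2 cinf c1 N I" "\<not> transport_cost p I f0 < transport_cost p I f"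
      using f0 by (auto simp: is_arg_min_def)
    then show "f \<in> admissible Z2 cinf c1 N I \<and> transport_cost p I f \<le> B" using f0_cost by linarith
  next
    assume "f \<in> admissible Z2 cinf c1 N I \<and> transport_cost p I f \<le> B"
    then show "is_arg_min (transport_cost p I) (\<lambda>g. g \<in> admissible Z2 cinf c1 N I) f"
      using ge by (force simp: is_arg_min_def)
  qed
  have "B = (d powr p) powr (1 / p) * (c1 / 2) powr (1 / p)"
    unfolding B_def by (rule powr_mult)
  also have "\<dots> = d * (c1 powr (1 / p) / 2 powr (1 / p))"
    using d0 assms(3,5) by (simp add: powr_powr powr_divide)
  also have "\<dots> = (2 powr - 1 * 2 powr (- (1 / p))) * (c1 / (real N * cinf)) * c1 powr (1 / p)"
    by (simp add: d_def powr_minus field_simps)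
  also have "2 powr - 1 * 2 powr (- (1 / p)) = (2::real) powr (- ((p + 1) / p))"
  proof -
    have "- ((p + 1) / p) = - 1 + - (1 / p)" using assms(3) by (simp add: field_simps)
    then show ?thesis by (simp only: powr_add)
  qed
  finally have B_eq: "B = 2 powr (- ((p + 1) / p)) * (c1 / (real N * cinf)) * c1 powr (1 / p)" .
  show ?thesis
    unfolding argmin d_def[symmetric] B_eq[symmetric]
    using f0 f0_cost opt le ge by (metis antisym)
qed

end
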